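(* Let $\lambda\in\mathbf R$ and write $Q=Q(\lambda,1)$, $f=f(\lambda)$ (notation of the context). (i) If $f>0$, there is no real touching conic of special type on $H_\lambda$. (ii) If $f<0$, there exists a family of real touching conics of special type on $H_\lambda$, parametrized by a circle, with defining equations $$\sqrt{Q^2-f}\,y_1^2+\sqrt{\frac{\sqrt{Q^2-f}-Q}{2}}\,e^{i\theta}y_1y_2+\sqrt{\frac{\sqrt{Q^2-f}-Q}{2}}\,e^{-i\theta}y_1y_3+y_2y_3=0,\qquad\theta\in\mathbf R,$$ and every real touching conic of special type in $H_\lambda$ is a member of this family. (iii) If $f<0$, the conic displayed in (ii) has no real point for any $\theta\in\mathbf R$.
   Context: Fix real numbers $a,b>0$ and a real quadratic form $Q(y_0,y_1)$; put $f(\lambda)=\lambda(\lambda+1)(a\lambda-b)$. Assume: there is $\lambda_0\in\mathbf R$ such that $Q(\lambda,1)^2-f(\lambda)\ge0$ for all $\lambda\in\mathbf R$ with equality iff $\lambda=\lambda_0$, and $\lambda_0$ is a root of multiplicity two; and $Q(\lambda,1)>\sqrt{f(\lambda)}$ whenever $\lambda\in\mathbf R$, $f(\lambda)\ge0$, $\lambda\ne\lambda_0$. $B\subset\mathbf{CP}^3$ is the quartic surface $(y_2y_3+Q(y_0,y_1))^2-y_0y_1(y_0+y_1)(ay_0-by_1)=0$; the real structure on $\mathbf{CP}^3$ is $\sigma(y_0:y_1:y_2:y_3)=(\overline y_0:\overline y_1:\overline y_3:\overline y_2)$. For $\lambda\in\mathbf R$, $H_\lambda=\{y_0=\lambda y_1\}$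 is a real plane with homogeneous coordinates $(y_1:y_2:y_3)$, and $B_\lambda=B\cap H_\lambda$ is the quartic curve $(y_2y_3+Qy_1^2)^2-fy_1^4=0$. Put $P_\infty=(0:0:0:1)$, $\overline P_\infty=(0:0:1:0)$. "Real" means invariant under $\sigma$. A real touching conic in $H_\lambda$ is a real irreducible conic $C\subset H_\lambda$ such that either $C\subset B$ or the local intersection number of $C$ with $B_\lambda$ is at least two at every intersection point. It is of special type if $(C,B_\lambda)_{P_\infty}=(C,B_\lambda)_{\overline P_\infty}=2$ (local intersection numbers). All square roots are positive; note $\sqrt{Q^2-f}-Q>0$ when $f<0$. *)

theory Defs
  imports "HOL-Analysis.Analysis" "HOL-Computational_Algebra.Computational_Algebra"
begin

definition proj_rel ::
  "complex \<times> complex \<times> complex \<times> complex \<Rightarrow> complex \<times> complex \<times> complex \<times> complex \<Rightarrow> bool" where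
  "proj_rel = (\<lambda>(x0, x1, x2, x3) (y0, y1, y2, y3).
     (x0, x1, x2, x3) \<noteq> (0, 0, 0, 0) \<and>
     (\<exists>c. c \<noteq> 0 \<and> y0 = c * x0 \<and> y1 = c * x1 \<and> y2 = c * x2 \<and> y3 = c * x3))"

quotient_type cp3 = "complex \<times> complex \<times> complex \<times> complex" / partial: proj_rel
proof (rule part_equivpI)
  show "\<exists>x. proj_rel x x"
    by (rule exI[of _ "(1, 0, 0, 0)"]) (auto simp: proj_rel_def intro!: exI[of _ 1])
  show "symp proj_rel"
  proof (rule sympI)
    fix x y assume "proj_rel x y"
    then obtain x0 x1 x2 x3 c where *: "x = (x0, x1, x2, x3)" "x \<noteq> (0, 0, 0, 0)" "c \<noteq> 0"
        "y = (c * x0, c * x1, c * x2, c * x3)"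
      by (cases x; cases y) (auto simp: proj_rel_def)
    then show "proj_rel y x"
      by (auto simp: proj_rel_def intro!: exI[of _ "inverse c"])
  qed
  show "transp proj_rel"
  proof (rule transpI)
    fix x y z assume "proj_rel x y" "proj_rel y z"
    then obtain x0 x1 x2 x3 c d where "x = (x0, x1, x2, x3)" "x \<noteq> (0, 0, 0, 0)" "c \<noteq> 0" "d \<noteq> 0"
        "z = (d * (c * x0), d * (c * x1), d * (c * x2), d * (c * x3))"
      by (cases x; cases y; cases z) (auto simp: proj_rel_def)
    then show "proj_rel x z"
      by (auto simp: proj_rel_def intro!: exI[of _ "d * c"])
  qed
qed

text \<open>The point \<open>(y0 : y1 : y2 : y3)\<close>; meaningful only if the coordinates are not all zero.\<close>

definition pt :: "complex \<Rightarrow> complex \<Rightarrow> complex \<Rightarrow> complex \<Rightarrow> cp3" where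
  "pt y0 y1 y2 y3 = abs_cp3 (y0, y1, y2, y3)"

lemma pt_eq_iff:
  assumes "(x0, x1, x2, x3) \<noteq> (0, 0, 0, 0)" "(y0, y1, y2, y3) \<noteq> (0, 0, 0, 0)"
  shows "pt x0 x1 x2 x3 = pt y0 y1 y2 y3 \<longleftrightarrow>
    (\<exists>c. c \<noteq> 0 \<and> y0 = c * x0 \<and> y1 = c * x1 \<and> y2 = c * x2 \<and> y3 = c * x3)"
proof -
  have refl: "proj_rel (x0, x1, x2, x3) (x0, x1, x2, x3)" "proj_rel (y0, y1, y2, y3) (y0, y1, y2, y3)"
    using assms by (auto simp: proj_rel_def intro!: exI[of _ 1])
  have "pt x0 x1 x2 x3 = pt y0 y1 y2 y3 \<longleftrightarrow> proj_rel (x0, x1, x2, x3) (y0, y1, y2, y3)"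
    unfolding pt_def using Quotient_rel[OF Quotient_cp3] refl by blast
  then show ?thesis using assms by (auto simp: proj_rel_def)
qed

lift_definition cp3_sigma :: "cp3 \<Rightarrow> cp3" is
  "\<lambda>(y0, y1, y2, y3). (cnj y0, cnj y1, cnj y3, cnj y2)"
  by (auto simp: proj_rel_def)

lemma cp3_sigma_pt:
  assumes "(y0, y1, y2, y3) \<noteq> (0, 0, 0, 0)"
  shows "cp3_sigma (pt y0 y1 y2 y3) = pt (cnj y0) (cnj y1) (cnj y3) (cnj y2)"
proof -
  have "proj_rel (y0, y1, y2, y3) (y0, y1, y2, y3)"
    using assms by (auto simp: proj_rel_def intro!: exI[of _ 1])
  then show ?thesis by (simp add: pt_def cp3_sigma.abs_eq)
qed

text \<open>A real binary quadratic form is given by its coefficients: \<open>(q0, q1, q2)\<close> stands for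
  \<open>q0 y0\<^sup>2 + q1 y0 y1 + q2 y1\<^sup>2\<close>.\<close>

type_synonym binary_form = "real \<times> real \<times> real"

fun qform :: "binary_form \<Rightarrow> 'a \<Rightarrow> 'a \<Rightarrow> 'a :: {real_algebra_1, comm_ring_1}" where
  "qform (q0, q1, q2) y0 y1 = of_real q0 * y0^2 + of_real q1 * y0 * y1 + of_real q2 * y1^2"

fun qform_poly :: "binary_form \<Rightarrow> real poly" where
  "qform_poly (q0, q1, q2) = [:q2, q1, q0:]"

lemma poly_qform_poly: "poly (qform_poly Q) t = qform Q t 1"
  by (cases Q) (simp add: algebra_simps power2_eq_square)

definition cubic :: "real \<Rightarrow> real \<Rightarrow> real \<Rightarrow> real" where
  "cubic a b t = t * (t + 1) * (a * t - b)"

definition cubic_poly :: "real \<Rightarrow> real \<Rightarrow> real poly" where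
  "cubic_poly a b = [:0, 1:] * [:1, 1:] * [:- b, a:]"

lemma poly_cubic_poly: "poly (cubic_poly a b) t = cubic a b t"
  by (simp add: cubic_poly_def cubic_def algebra_simps)

definition quartic_surface :: "real \<Rightarrow> real \<Rightarrow> binary_form \<Rightarrow> cp3 set" where
  "quartic_surface a b Q = {pt y0 y1 y2 y3 | y0 y1 y2 y3.
     (y0, y1, y2, y3) \<noteq> (0, 0, 0, 0) \<and>
     (y2 * y3 + qform Q y0 y1)^2
       - y0 * y1 * (y0 + y1) * (of_real a * y0 - of_real b * y1) = 0}"

text \<open>Polynomials in \<open>y1, y2, y3\<close> over the complex numbers are iterated univariate polynomials,
  \<open>y3\<close> being the outermost variable.\<close>

type_synonym poly3 = "complex poly poly poly"

definition cst :: "complex \<Rightarrow> poly3" where "cst c = [:[:[:c:]:]:]"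
definition Y1 :: poly3 where "Y1 = [:[:[:0, 1:]:]:]"
definition Y2 :: poly3 where "Y2 = [:[:0, 1:]:]"
definition Y3 :: poly3 where "Y3 = [:0, 1:]"

fun eval3 :: "poly3 \<Rightarrow> complex \<times> complex \<times> complex \<Rightarrow> complex" where
  "eval3 F (y1, y2, y3) = poly (poly (poly F [:[:y3:]:]) [:y2:]) y1"

definition homogeneous :: "nat \<Rightarrow> poly3 \<Rightarrow> bool" where
  "homogeneous d F \<longleftrightarrow>
     (\<forall>i j k. coeff (coeff (coeff F i) j) k \<noteq> 0 \<longrightarrow> i + j + k = d)"

text \<open>The local ring of the projective plane at \<open>P\<close>, as a subring of the field of rational
  functions, and its ideal generated by the local equations of the curves \<open>F = 0\<close> and \<open>G = 0\<close>.\<close>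

definition local_ring :: "complex \<times> complex \<times> complex \<Rightarrow> poly3 fract set" where
  "local_ring P = {Fract A D | A D d.
     homogeneous d A \<and> homogeneous d D \<and> eval3 D P \<noteq> 0}"

definition local_ideal :: "complex \<times> complex \<times> complex \<Rightarrow> poly3 \<Rightarrow> poly3 \<Rightarrow> poly3 fract set" where
  "local_ideal P F G = {Fract (U * F + V * G) D | U V D d.
     homogeneous d (U * F) \<and> homogeneous d (V * G) \<and> homogeneous d D \<and> eval3 D P \<noteq> 0}"

text \<open>Dimension of the complex vector space \<open>V / W\<close>: the supremum of the cardinalities of finite
  subsets of \<open>V\<close> that are linearly independent modulo \<open>W\<close>.\<close>

definition quot_dim :: "poly3 fract set \<Rightarrow> poly3 fract set \<Rightarrow> enat" where
  "quot_dim V W = (SUP S \<in> {S. finite S \<and> S \<subseteq> V \<and>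
      (\<forall>c. (\<Sum>s\<in>S. Fract (cst (c s)) 1 * s) \<in> W \<longrightarrow> (\<forall>s\<in>S. c s = 0))}. enat (card S))"

text \<open>Local intersection number; it is infinite at a point lying on a common component.\<close>

definition int_mult :: "complex \<times> complex \<times> complex \<Rightarrow> poly3 \<Rightarrow> poly3 \<Rightarrow> enat" where
  "int_mult P F G = quot_dim (local_ring P) (local_ideal P F G)"

definition plane_pt :: "real \<Rightarrow> complex \<times> complex \<times> complex \<Rightarrow> cp3" where
  "plane_pt t = (\<lambda>(y1, y2, y3). pt (of_real t * y1) y1 y2 y3)"

definition plane_locus :: "real \<Rightarrow> poly3 \<Rightarrow> cp3 set" where
  "plane_locus t F = {plane_pt t y | y. y \<noteq> (0, 0, 0) \<and> eval3 F y = 0}"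

definition quartic_curve :: "real \<Rightarrow> real \<Rightarrow> binary_form \<Rightarrow> real \<Rightarrow> poly3" where
  "quartic_curve a b Q t =
     (Y2 * Y3 + cst (of_real (qform Q t 1)) * Y1^2)^2 - cst (of_real (cubic a b t)) * Y1^4"

lemma eval3_quartic_curve:
  "eval3 (quartic_curve a b Q t) (y1, y2, y3) =
     (y2 * y3 + of_real (qform Q t 1) * y1^2)^2 - of_real (cubic a b t) * y1^4"
  by (simp add: quartic_curve_def cst_def Y1_def Y2_def Y3_def mult.commute)

lemma plane_locus_quartic_curve:
  "plane_locus t (quartic_curve a b Q t) =
     quartic_surface a b Q \<inter> {pt y0 y1 y2 y3 | y0 y1 y2 y3.
       (y0, y1, y2, y3) \<noteq> (0, 0, 0, 0) \<and> y0 = of_real t * y1}"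
    (is "?L = ?R")
proof -
  have restrict: "eval3 (quartic_curve a b Q t) (y1, y2, y3) =
      (y2 * y3 + qform Q (of_real t * y1) y1)^2
       - of_real t * y1 * y1 * (of_real t * y1 + y1) * (of_real a * (of_real t * y1) - of_real b * y1)"
    for y1 y2 y3
    by (cases Q) (simp only: eval3_quartic_curve qform.simps cubic_def,
        simp add: algebra_simps power2_eq_square power4_eq_xxxx)
  show ?thesis
  proof
    show "?L \<subseteq> ?R"
    proof
      fix P assume "P \<in> ?L"
      then obtain y1 y2 y3 where P: "P = pt (of_real t * y1) y1 y2 y3" "(y1, y2, y3) \<noteq> (0, 0, 0)"
          "eval3 (quartic_curve a b Q t) (y1, y2, y3) = 0"
        by (auto simp: plane_locus_def plane_pt_def simp del: eval3.simps)
      then have "(of_real t * y1, y1, y2, y3) \<noteq> (0, 0, 0, 0)" by auto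
      then show "P \<in> ?R" using P unfolding restrict quartic_surface_def by blast
    qed
    show "?R \<subseteq> ?L"
    proof
      fix P assume "P \<in> ?R"
      then obtain x0 x1 x2 x3 y1 y2 y3 where
        x: "P = pt x0 x1 x2 x3" "(x0, x1, x2, x3) \<noteq> (0, 0, 0, 0)"
          "(x2 * x3 + qform Q x0 x1)^2 - x0 * x1 * (x0 + x1) * (of_real a * x0 - of_real b * x1) = 0"
        and y: "P = pt (of_real t * y1) y1 y2 y3" "(of_real t * y1, y1, y2, y3) \<noteq> (0, 0, 0, 0)"
        unfolding quartic_surface_def by blast
      obtain c where "c \<noteq> 0" "of_real t * y1 = c * x0" "y1 = c * x1"
        using x(1) y(1) pt_eq_iff[OF x(2) y(2)] by auto
      then have x0: "x0 = of_real t * x1"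
        by (metis mult.left_commute mult_cancel_left)
      then have "eval3 (quartic_curve a b Q t) (x1, x2, x3) = 0"
        using x(3) restrict by simp
      moreover have "P = plane_pt t (x1, x2, x3)" "(x1, x2, x3) \<noteq> (0, 0, 0)"
        using x x0 by (auto simp: plane_pt_def)
      ultimately show "P \<in> ?L" unfolding plane_locus_def by blast
    qed
  qed
qed

text \<open>A conic is represented by a defining equation \<open>F\<close>, unique up to a nonzero constant.\<close>

definition irreducible_conic :: "poly3 \<Rightarrow> bool" where
  "irreducible_conic F \<longleftrightarrow> homogeneous 2 F \<and> irreducible F"

definition real_touching_conic :: "real \<Rightarrow> real \<Rightarrow> binary_form \<Rightarrow> real \<Rightarrow> poly3 \<Rightarrow> bool" where
  "real_touching_conic a b Q t F \<longleftrightarrow>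
     irreducible_conic F \<and>
     cp3_sigma ` plane_locus t F = plane_locus t F \<and>
     (plane_locus t F \<subseteq> quartic_surface a b Q \<or>
      (\<forall>y. y \<noteq> (0, 0, 0) \<and> plane_pt t y \<in> plane_locus t F \<inter> quartic_surface a b Q \<longrightarrow>
         2 \<le> int_mult y F (quartic_curve a b Q t)))"

text \<open>In the coordinates \<open>(y1 : y2 : y3)\<close> the points \<open>(0:0:0:1)\<close> and \<open>(0:0:1:0)\<close> of projective
  3-space are \<open>(0:0:1)\<close> and \<open>(0:1:0)\<close>.\<close>

definition special_type :: "real \<Rightarrow> real \<Rightarrow> binary_form \<Rightarrow> real \<Rightarrow> poly3 \<Rightarrow> bool" where
  "special_type a b Q t F \<longleftrightarrow>
     int_mult (0, 0, 1) F (quartic_curve a b Q t) = 2 \<and>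
     int_mult (0, 1, 0) F (quartic_curve a b Q t) = 2"

text \<open>The arguments \<open>q\<close> and \<open>f\<close> are the values at \<open>t\<close> of the quadratic form and the cubic.\<close>

definition conic_family :: "real \<Rightarrow> real \<Rightarrow> real \<Rightarrow> poly3" where
  "conic_family q f \<theta> =
     cst (of_real (sqrt (q^2 - f))) * Y1^2
     + cst (of_real (sqrt ((sqrt (q^2 - f) - q) / 2)) * exp (\<i> * of_real \<theta>)) * Y1 * Y2
     + cst (of_real (sqrt ((sqrt (q^2 - f) - q) / 2)) * exp (- \<i> * of_real \<theta>)) * Y1 * Y3
     + Y2 * Y3"

end

theory Submission
  imports Defs
begin

text \<open>Over \<open>\<lambda>\<close> the quartic splits as \<open>(y2 y3 + \<alpha> y1\<^sup>2) (y2 y3 + \<beta> y1\<^sup>2)\<close> with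
  \<open>\<alpha>, \<beta> = Q \<plusminus> \<surd>f\<close>. A touching conic of special type passes through both points at infinity
  transversally to the quartic, so up to a scalar it is \<open>A y1\<^sup>2 + B y1 y2 + C y1 y3 + y2 y3\<close>, where
  reality means \<open>A\<close> real and \<open>C = cnj B\<close>, and \<open>B \<noteq> 0\<close>. Away from infinity it meets the component
  \<open>y2 y3 + \<alpha> y1\<^sup>2\<close> in the roots \<open>u = y2 / y1\<close> of \<open>B u\<^sup>2 + (A - \<alpha>) u - \<alpha> C\<close>; simple roots are
  transversal intersections, so touching forces \<open>(A - \<alpha>)\<^sup>2 + 4 \<alpha> \<bar>B\<bar>\<^sup>2 = 0\<close>. For \<open>f > 0\<close> this is
  impossible since \<open>\<alpha> = Q + \<surd>f > 0\<close>. For \<open>f < 0\<close> real and imaginary parts give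
  \<open>A = \<surd>(Q\<^sup>2 - f)\<close> and \<open>2 \<bar>B\<bar>\<^sup>2 = A - Q\<close>, leaving only the argument of \<open>B\<close> free.

  Intersection numbers are bounded below by restricting to an arc along which both curves vanish, and
  above by exhibiting a local parameter some power of which lies in the ideal of the two curves.\<close>

section \<open>Forms in three variables\<close>

declare eval3.simps [simp del]

lemma cst_hom [simp]:
  "cst (c + d) = cst c + cst d" "cst (c * d) = cst c * cst d" "cst (- c) = - cst c"
  "cst (c - d) = cst c - cst d" "cst 0 = 0" "cst 1 = 1"
  by (simp_all add: cst_def one_pCons)

lemma eval3_hom [simp]:
  "eval3 (F + G) P = eval3 F P + eval3 G P"
  "eval3 (F * G) P = eval3 F P * eval3 G P"
  "eval3 (- F) P = - eval3 F P"
  "eval3 (F - G) P = eval3 F P - eval3 G P"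
  "eval3 0 P = 0" "eval3 1 P = 1" "eval3 (cst c) P = c"
  by (cases P; simp add: eval3.simps cst_def)+

lemma eval3_Y [simp]:
  "eval3 Y1 (y1, y2, y3) = y1" "eval3 Y2 (y1, y2, y3) = y2" "eval3 Y3 (y1, y2, y3) = y3"
  by (simp_all add: eval3.simps Y1_def Y2_def Y3_def)

lemma eval3_power [simp]: "eval3 (F ^ n) P = eval3 F P ^ n"
  by (induction n) simp_all

lemma eval3_sum: "eval3 (sum f S) P = (\<Sum>x\<in>S. eval3 (f x) P)"
  by (induction S rule: infinite_finite_induct) simp_all

lemma homogeneous_0 [simp]: "homogeneous d 0"
  by (simp add: homogeneous_def)

lemma homogeneous_add [intro]: "homogeneous d F \<Longrightarrow> homogeneous d G \<Longrightarrow> homogeneous d (F + G)"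
  unfolding homogeneous_def by (metis coeff_add add.right_neutral)

lemma homogeneous_minus [simp]: "homogeneous d (- F) \<longleftrightarrow> homogeneous d F"
  by (simp add: homogeneous_def)

lemma homogeneous_diff [intro]: "homogeneous d F \<Longrightarrow> homogeneous d G \<Longrightarrow> homogeneous d (F - G)"
  using homogeneous_add[of d F "- G"] by simp

lemma homogeneous_mult:
  assumes "homogeneous d F" "homogeneous e G"
  shows "homogeneous (d + e) (F * G)"
  unfolding homogeneous_def
proof (intro allI impI)
  fix i j k
  assume "coeff (coeff (coeff (F * G) i) j) k \<noteq> 0"
  then have "(\<Sum>a\<le>i. \<Sum>b\<le>j. \<Sum>c\<le>k. coeff (coeff (coeff F a) b) c *
      coeff (coeff (coeff G (i - a)) (j - b)) (k - c)) \<noteq> 0"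
    by (simp add: coeff_mult coeff_sum)
  then obtain a b c where "a \<le> i" "b \<le> j" "c \<le> k" "coeff (coeff (coeff F a) b) c \<noteq> 0"
    "coeff (coeff (coeff G (i - a)) (j - b)) (k - c) \<noteq> 0"
    by (elim sum.not_neutral_contains_not_neutral) auto
  moreover from this assms have "a + b + c = d" "(i - a) + (j - b) + (k - c) = e"
    unfolding homogeneous_def by blast+
  ultimately show "i + j + k = d + e" by linarith
qed

lemma homogeneous_cst [simp]: "homogeneous 0 (cst c)"
  by (auto simp: homogeneous_def cst_def coeff_pCons split: nat.splits)

lemma homogeneous_1 [simp]: "homogeneous 0 1"
  using homogeneous_cst[of 1] by simp

lemma homogeneous_Y [simp]: "homogeneous (Suc 0) Y1" "homogeneous (Suc 0) Y2" "homogeneous (Suc 0) Y3"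
  by (auto simp: homogeneous_def Y1_def Y2_def Y3_def coeff_pCons one_pCons split: nat.splits if_splits)

lemma homogeneous_cst_mult [intro]: "homogeneous d F \<Longrightarrow> homogeneous d (cst c * F)"
  using homogeneous_mult[OF homogeneous_cst] by simp

lemma homogeneous_power: "homogeneous d F \<Longrightarrow> homogeneous (n * d) (F ^ n)"
  by (induction n) (auto intro: homogeneous_mult)

lemma homogeneous_mult': "homogeneous d F \<Longrightarrow> homogeneous e G \<Longrightarrow> n = d + e \<Longrightarrow> homogeneous n (F * G)"
  using homogeneous_mult by blast

lemma homogeneous_power': "homogeneous d F \<Longrightarrow> n = k * d \<Longrightarrow> homogeneous n (F ^ k)"
  using homogeneous_power by blast

text \<open>The three layers of iterated polynomials are expanded one after the other; this works
  because passing to a constant polynomial commutes with products, powers and sums.\<close>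

lemma poly3_eq_sum_monomials:
  "F = (\<Sum>i\<le>degree F. \<Sum>j\<le>degree (coeff F i). \<Sum>k\<le>degree (coeff (coeff F i) j).
         cst (coeff (coeff (coeff F i) j) k) * Y1 ^ k * Y2 ^ j * Y3 ^ i)"
proof -
  have expand: "p = (\<Sum>i\<le>degree p. [:coeff p i:] * [:0, 1:] ^ i)" for p :: "'a :: comm_ring_1 poly"
    by (simp add: poly_as_sum_of_monoms flip: monom_altdef)
  have hom: "[:p * q:] = [:p:] * [:q:]" for p q :: "'a :: comm_ring_1"
    by simp
  have pw: "[:p ^ n:] = [:p:] ^ n" for p :: "'a :: comm_ring_1" and n
  proof (induction n)
    case (Suc n)
    have "[:p ^ Suc n:] = [:p:] * [:p ^ n:]" by simp
    then show ?case by (simp only: Suc power_Suc)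
  qed (simp add: one_pCons)
  have sm: "[:sum f S:] = (\<Sum>x\<in>S. [:f x:])" for f :: "'b \<Rightarrow> 'a :: comm_ring_1" and S
  proof (induction S rule: infinite_finite_induct)
    case (insert x S)
    have "[:f x + sum f S:] = [:f x:] + [:sum f S:]" by simp
    then show ?case using insert by (simp only: sum.insert not_False_eq_True)
  qed simp_all
  have 1: "[:[:p:]:] = (\<Sum>k\<le>degree p. cst (coeff p k) * Y1 ^ k)" for p
    unfolding cst_def Y1_def pw[symmetric] hom[symmetric] sm[symmetric]
    using expand[of p] by simp
  have 2: "[:p:] = (\<Sum>j\<le>degree p. [:[:coeff p j:]:] * Y2 ^ j)" for p
    unfolding Y2_def pw[symmetric] hom[symmetric] sm[symmetric]
    using expand[of p] by simp
  show ?thesis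
    unfolding sum_distrib_right[symmetric] 1[symmetric] 2[symmetric] Y3_def
    by (rule expand)
qed

text \<open>The monomial expansion reduces a claim closed under addition to single monomials. A
  monomial of the wrong degree has coefficient zero and falls under \<open>P 0\<close>.\<close>

lemma homogeneous_induct [consumes 1, case_names zero add monomial]:
  assumes "homogeneous d F" and "P 0" and "\<And>F G. P F \<Longrightarrow> P G \<Longrightarrow> P (F + G)"
    and "\<And>c i j k. i + j + k = d \<Longrightarrow> P (cst c * Y1 ^ k * Y2 ^ j * Y3 ^ i)"
  shows "P F"
proof -
  have sum: "P (sum f S)" if "\<And>x. x \<in> S \<Longrightarrow> P (f x)" for f :: "nat \<Rightarrow> poly3" and S
    using that assms(2,3) by (induction S rule: infinite_finite_induct) auto
  have "P (cst (coeff (coeff (coeff F i) j) k) * Y1 ^ k * Y2 ^ j * Y3 ^ i)" for i j k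
    using assms(1,2,4) unfolding homogeneous_def
    by (cases "coeff (coeff (coeff F i) j) k = 0") auto
  then have "P (\<Sum>i\<le>degree F. \<Sum>j\<le>degree (coeff F i). \<Sum>k\<le>degree (coeff (coeff F i) j).
         cst (coeff (coeff (coeff F i) j) k) * Y1 ^ k * Y2 ^ j * Y3 ^ i)"
    by (intro sum)
  then show ?thesis
    using poly3_eq_sum_monomials[of F] by simp
qed

lemma homogeneous_2_expand:
  assumes "homogeneous 2 F"
  obtains A B C D E G where
    "F = cst A * Y1^2 + cst B * Y1 * Y2 + cst C * Y1 * Y3 + cst D * Y2^2 + cst E * Y2 * Y3 + cst G * Y3^2"
proof -
  \<comment> \<open>As the range of a map on coefficient tuples, the six-term shape is visibly
    closed under addition, as the induction over monomials demands.\<close>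
  define form where "form = (\<lambda>(A, B, C, D, E, G).
    cst A * Y1^2 + cst B * Y1 * Y2 + cst C * Y1 * Y3 + cst D * Y2^2 + cst E * Y2 * Y3 + cst G * Y3^2)"
  have "F \<in> range form"
    using assms
  proof (induction rule: homogeneous_induct)
    case zero
    show ?case by (rule range_eqI[of _ _ "(0, 0, 0, 0, 0, 0)"]) (simp add: form_def)
  next
    case (add F G)
    then obtain a b c d e g a' b' c' d' e' g' where "F = form (a, b, c, d, e, g)"
      "G = form (a', b', c', d', e', g')"
      by auto
    then show ?case
      by (intro range_eqI[of _ _ "(a + a', b + b', c + c', d + d', e + e', g + g')"])
        (simp add: form_def algebra_simps)
  next
    case (monomial c i j k)
    then have "i \<in> {0, 1, 2}" "j \<in> {0, 1, 2}" "k = 2 - i - j" "i + j \<le> 2"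
      by auto
    then consider "i = 0" "j = 0" "k = 2" | "i = 0" "j = 1" "k = 1" | "i = 1" "j = 0" "k = 1"
      | "i = 0" "j = 2" "k = 0" | "i = 1" "j = 1" "k = 0" | "i = 2" "j = 0" "k = 0"
      by force
    then show ?case
    proof cases
      case 1 then show ?thesis by (intro range_eqI[of _ _ "(c, 0, 0, 0, 0, 0)"]) (simp add: form_def)
    next
      case 2 then show ?thesis by (intro range_eqI[of _ _ "(0, c, 0, 0, 0, 0)"]) (simp add: form_def)
    next
      case 3 then show ?thesis by (intro range_eqI[of _ _ "(0, 0, c, 0, 0, 0)"]) (simp add: form_def)
    next
      case 4 then show ?thesis by (intro range_eqI[of _ _ "(0, 0, 0, c, 0, 0)"]) (simp add: form_def)
    next
      case 5 then show ?thesis by (intro range_eqI[of _ _ "(0, 0, 0, 0, c, 0)"]) (simp add: form_def)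
    next
      case 6 then show ?thesis by (intro range_eqI[of _ _ "(0, 0, 0, 0, 0, c)"]) (simp add: form_def)
    qed
  qed
  then show ?thesis
    using that by (auto simp: form_def)
qed

text \<open>Lets identities between forms be pulled back to one-variable polynomials in the
  parameter of an arc, where orders of vanishing can be read off.\<close>

lemma eval3_along_curve:
  obtains q where "\<And>s. eval3 F (poly p1 s, poly p2 s, poly p3 s) = poly q s"
proof
  fix s
  have "eval3 F (poly p1 s, poly p2 s, poly p3 s) =
    (\<Sum>i\<le>degree F. \<Sum>j\<le>degree (coeff F i). \<Sum>k\<le>degree (coeff (coeff F i) j).
         coeff (coeff (coeff F i) j) k * poly p1 s ^ k * poly p2 s ^ j * poly p3 s ^ i)"
    by (subst poly3_eq_sum_monomials) (simp add: eval3_sum)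
  then show "eval3 F (poly p1 s, poly p2 s, poly p3 s) =
    poly (\<Sum>i\<le>degree F. \<Sum>j\<le>degree (coeff F i). \<Sum>k\<le>degree (coeff (coeff F i) j).
         smult (coeff (coeff (coeff F i) j) k) (p1 ^ k * p2 ^ j * p3 ^ i)) s"
    by (simp add: poly_sum mult.assoc)
qed

section \<open>The local ring and the intersection multiplicity\<close>

lemma Fract_power: "Fract A B ^ n = Fract (A ^ n) (B ^ n)" for A B :: "'a :: idom"
  by (induction n) (simp_all add: One_fract_def)

lemma Fract_add_same: "Fract (A + B) D = Fract A D + Fract B D" for A B D :: "'a :: idom"
proof (cases "D = 0")
  case False
  then show ?thesis by (simp add: eq_fract algebra_simps)
qed (simp add: fract_collapse)

lemma Fract_sum: "Fract (sum f S) D = (\<Sum>i\<in>S. Fract (f i) D)" for D :: "'a :: idom"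
  by (induction S rule: infinite_finite_induct) (simp_all add: Fract_add_same fract_collapse)

definition scal :: "complex \<Rightarrow> poly3 fract" where
  "scal c = Fract (cst c) 1"

lemma scal_hom [simp]:
  "scal (c + d) = scal c + scal d" "scal (c * d) = scal c * scal d" "scal (- c) = - scal c"
  "scal (c - d) = scal c - scal d" "scal 0 = 0" "scal 1 = 1"
  by (simp_all add: scal_def fract_collapse)

lemma scal_sum: "scal (sum f S) = (\<Sum>x\<in>S. scal (f x))"
  by (induction S rule: infinite_finite_induct) simp_all

lemma scal_inverse: "c \<noteq> 0 \<Longrightarrow> scal c * scal (1 / c) = 1"
  by (simp flip: scal_hom(2))

lemma local_ringI:
  "homogeneous d A \<Longrightarrow> homogeneous d D \<Longrightarrow> eval3 D P \<noteq> 0 \<Longrightarrow> Fract A D \<in> local_ring P"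
  unfolding local_ring_def by blast

lemma local_ringE:
  assumes "x \<in> local_ring P"
  obtains A D d where "x = Fract A D" "homogeneous d A" "homogeneous d D" "eval3 D P \<noteq> 0" "D \<noteq> 0"
  using assms unfolding local_ring_def by force

lemma scal_in_local_ring [simp]: "scal c \<in> local_ring P"
  unfolding scal_def by (rule local_ringI[of 0]) auto

lemma local_ring_add:
  assumes "x \<in> local_ring P" "y \<in> local_ring P"
  shows "x + y \<in> local_ring P"
proof -
  obtain A D d where x: "x = Fract A D" "homogeneous d A" "homogeneous d D" "eval3 D P \<noteq> 0" "D \<noteq> 0"
    using assms by (elim local_ringE)
  obtain B E e where y: "y = Fract B E" "homogeneous e B" "homogeneous e E" "eval3 E P \<noteq> 0" "E \<noteq> 0"
    using assms by (elim local_ringE)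
  have "Fract (A * E + B * D) (D * E) \<in> local_ring P"
    using x y by (intro local_ringI[of "d + e"] homogeneous_add)
      (auto intro: homogeneous_mult homogeneous_mult')
  then show ?thesis using x y by simp
qed

lemma local_ring_mult:
  assumes "x \<in> local_ring P" "y \<in> local_ring P"
  shows "x * y \<in> local_ring P"
proof -
  obtain A D d where x: "x = Fract A D" "homogeneous d A" "homogeneous d D" "eval3 D P \<noteq> 0" "D \<noteq> 0"
    using assms by (elim local_ringE)
  obtain B E e where y: "y = Fract B E" "homogeneous e B" "homogeneous e E" "eval3 E P \<noteq> 0" "E \<noteq> 0"
    using assms by (elim local_ringE)
  have "Fract (A * B) (D * E) \<in> local_ring P"
    using x y by (intro local_ringI[of "d + e"]) (auto intro: homogeneous_mult)
  then show ?thesis using x y by simp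
qed

lemma local_ring_0 [simp]: "0 \<in> local_ring P" and local_ring_1 [simp]: "1 \<in> local_ring P"
  using scal_in_local_ring[of 0 P] scal_in_local_ring[of 1 P] by simp_all

lemma local_ring_power: "x \<in> local_ring P \<Longrightarrow> x ^ n \<in> local_ring P"
  by (induction n) (auto intro: local_ring_mult)

text \<open>Only the fraction counts, so the form \<open>E\<close> may even vanish at
  \<open>P\<close>, provided the same fraction has a denominator \<open>D\<close> that does
  not.\<close>

lemma local_idealI:
  assumes "homogeneous d (U * F)" "homogeneous d (V * G)" "homogeneous d D" "eval3 D P \<noteq> 0"
    and "N * D = (U * F + V * G) * E" "E \<noteq> 0"
  shows "Fract N E \<in> local_ideal P F G"
proof -
  have "D \<noteq> 0" using assms(4) by auto
  then have "Fract N E = Fract (U * F + V * G) D"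
    using assms by (simp add: eq_fract)
  then show ?thesis
    unfolding local_ideal_def using assms by blast
qed

lemma local_idealE:
  assumes "x \<in> local_ideal P F G"
  obtains U V D d where "x = Fract (U * F + V * G) D" "homogeneous d (U * F)" "homogeneous d (V * G)"
    "homogeneous d D" "eval3 D P \<noteq> 0" "D \<noteq> 0"
  using assms unfolding local_ideal_def by force

lemma local_ideal_0 [simp]: "0 \<in> local_ideal P F G"
  using local_idealI[of 0 0 F 0 G 1 P 0 1] by (simp add: fract_collapse)

lemma local_ideal_add:
  assumes "x \<in> local_ideal P F G" "y \<in> local_ideal P F G"
  shows "x + y \<in> local_ideal P F G"
proof -
  obtain U V D d where x: "x = Fract (U * F + V * G) D" "homogeneous d (U * F)" "homogeneous d (V * G)"
    "homogeneous d D" "eval3 D P \<noteq> 0" "D \<noteq> 0"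
    using assms by (elim local_idealE)
  obtain U' V' E e where y: "y = Fract (U' * F + V' * G) E" "homogeneous e (U' * F)" "homogeneous e (V' * G)"
    "homogeneous e E" "eval3 E P \<noteq> 0" "E \<noteq> 0"
    using assms by (elim local_idealE)
  have "homogeneous (d + e) ((U * F) * E + (U' * F) * D)"
    "homogeneous (d + e) ((V * G) * E + (V' * G) * D)"
    using x y by (intro homogeneous_add; auto intro: homogeneous_mult homogeneous_mult')+
  then have "Fract ((U * F + V * G) * E + (U' * F + V' * G) * D) (D * E) \<in> local_ideal P F G"
    using x y by (intro local_idealI[of "d + e" "U * E + U' * D" F "V * E + V' * D" G "D * E"])
      (auto intro: homogeneous_mult simp: algebra_simps)
  then show ?thesis using x y by simp
qed

lemma local_ideal_mult:
  assumes "x \<in> local_ring P" "y \<in> local_ideal P F G"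
  shows "x * y \<in> local_ideal P F G"
proof -
  obtain A D d where x: "x = Fract A D" "homogeneous d A" "homogeneous d D" "eval3 D P \<noteq> 0" "D \<noteq> 0"
    using assms by (elim local_ringE)
  obtain U V E e where y: "y = Fract (U * F + V * G) E" "homogeneous e (U * F)" "homogeneous e (V * G)"
    "homogeneous e E" "eval3 E P \<noteq> 0" "E \<noteq> 0"
    using assms by (elim local_idealE)
  have "homogeneous (d + e) (A * (U * F))" "homogeneous (d + e) (A * (V * G))"
    using x y by (auto intro: homogeneous_mult)
  then have "Fract (A * (U * F + V * G)) (D * E) \<in> local_ideal P F G"
    using x y by (intro local_idealI[of "d + e" "A * U" F "A * V" G "D * E"])
      (auto intro: homogeneous_mult simp: algebra_simps)
  then show ?thesis using x y by simp
qed

lemma local_ideal_sum: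
  "(\<And>s. s \<in> S \<Longrightarrow> f s \<in> local_ideal P F G) \<Longrightarrow> sum f S \<in> local_ideal P F G"
  by (induction S rule: infinite_finite_induct) (auto intro: local_ideal_add)

section \<open>Dimensions of quotients by the local ideal\<close>

text \<open>Passes from families to the sets counted by \<open>quot_dim\<close>. Independence itself
  forces injectivity: two equal members would give a nontrivial vanishing combination, namely their
  difference.\<close>

lemma quot_dim_ge:
  assumes V: "\<And>i. i < n \<Longrightarrow> e i \<in> V" and "0 \<in> W"
    and indep: "\<And>c i. (\<Sum>i<n. scal (c i) * e i) \<in> W \<Longrightarrow> i < n \<Longrightarrow> c i = 0"
  shows "enat n \<le> quot_dim V W"
proof -
  have inj: "inj_on e {..<n}"
  proof (rule inj_onI, rule ccontr)
    fix i j assume ij: "i \<in> {..<n}" "j \<in> {..<n}" "e i = e j" "i \<noteq> j"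
    define c :: "nat \<Rightarrow> complex" where "c = (\<lambda>k. of_bool (k = i) - of_bool (k = j))"
    have "(\<Sum>k<n. scal (c k) * e k) = (\<Sum>k<n. (if k = i then e i else 0) - (if k = j then e j else 0))"
      by (rule sum.cong) (auto simp: c_def)
    also have "\<dots> = 0"
      using ij by (simp add: sum_subtractf)
    finally have "c i = 0"
      using indep[of c i] ij \<open>0 \<in> W\<close> by simp
    then show False using ij by (simp add: c_def)
  qed
  show ?thesis
    unfolding quot_dim_def
  proof (rule SUP_upper2[where i = "e ` {..<n}"])
    show "enat n \<le> enat (card (e ` {..<n}))"
      using card_image[OF inj] by simp
    show "e ` {..<n} \<in> {S. finite S \<and> S \<subseteq> V \<and>
        (\<forall>c. (\<Sum>s\<in>S. Fract (cst (c s)) 1 * s) \<in> W \<longrightarrow> (\<forall>s\<in>S. c s = 0))}"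
      using V indep[of "\<lambda>i. _ (e i)"] by (auto simp: sum.reindex[OF inj] simp flip: scal_def)
  qed
qed

text \<open>One step of Gaussian elimination per coordinate: a vector \<open>t\<close> with nonzero
  last coordinate clears that coordinate from the others, and the induction hypothesis applies to
  the remaining vectors.\<close>

lemma ex_linear_dependency:
  fixes k :: "'b \<Rightarrow> nat \<Rightarrow> 'c :: field"
  assumes "finite S" "n < card S"
  shows "\<exists>c. (\<exists>s\<in>S. c s \<noteq> 0) \<and> (\<forall>i<n. (\<Sum>s\<in>S. c s * k s i) = 0)"
  using assms
proof (induction n arbitrary: S k)
  case 0
  then obtain s where "s \<in> S" by fastforce
  then show ?case by (intro exI[of _ "\<lambda>_. 1"]) auto
next
  case (Suc n)
  show ?case
  proof (cases "\<exists>t\<in>S. k t n \<noteq> 0")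
    case False
    then show ?thesis using Suc.IH[of S k] Suc.prems by (force simp: less_Suc_eq)
  next
    case True
    then obtain t where t: "t \<in> S" "k t n \<noteq> 0" by blast
    define k' where "k' s i = k s i - k s n / k t n * k t i" for s i
    have "n < card (S - {t})" using Suc.prems t by simp
    then obtain c where c: "\<exists>s\<in>S - {t}. c s \<noteq> 0" "\<forall>i<n. (\<Sum>s\<in>S - {t}. c s * k' s i) = 0"
      using Suc.IH[of "S - {t}" k'] Suc.prems by auto
    \<comment> \<open>Chosen so that \<open>t\<close> cancels the last coordinate of the
      combination; the same value turns a combination of the reduced vectors \<open>k'\<close> into
      one of the original vectors.\<close>
    define d where "d = - (\<Sum>s\<in>S - {t}. c s * k s n) / k t n"
    have sum: "(\<Sum>s\<in>S. (c(t := d)) s * k s i) = (\<Sum>s\<in>S - {t}. c s * k s i) + d * k t i" for i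
    proof -
      have "(\<Sum>s\<in>S - {t}. (c(t := d)) s * k s i) = (\<Sum>s\<in>S - {t}. c s * k s i)"
        by (rule sum.cong) auto
      then show ?thesis using t Suc.prems by (simp add: sum.remove[of S t])
    qed
    have "(\<Sum>s\<in>S - {t}. c s * k' s i) = (\<Sum>s\<in>S - {t}. c s * k s i) + d * k t i" for i
    proof -
      have "(\<Sum>s\<in>S - {t}. c s * k' s i) =
          (\<Sum>s\<in>S - {t}. c s * k s i - c s * k s n * (k t i / k t n))"
        by (rule sum.cong) (simp_all add: k'_def algebra_simps)
      also have "\<dots> = (\<Sum>s\<in>S - {t}. c s * k s i) + d * k t i"
        unfolding sum_subtractf sum_distrib_right[symmetric] d_def by simp
      finally show ?thesis .
    qed
    moreover have "(\<Sum>s\<in>S - {t}. c s * k s n) + d * k t n = 0"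
      using t by (simp add: d_def)
    ultimately have "\<forall>i<Suc n. (\<Sum>s\<in>S. (c(t := d)) s * k s i) = 0"
      using c(2) unfolding sum by (auto simp: less_Suc_eq)
    moreover have "\<exists>s\<in>S. (c(t := d)) s \<noteq> 0" using c(1) by auto
    ultimately show ?thesis by blast
  qed
qed

text \<open>More than \<open>n\<close> members would have linearly dependent coordinate vectors
  \<open>k\<close>, and the same coefficients would give a nontrivial combination of the members
  inside the ideal.\<close>

lemma quot_dim_local_ideal_le:
  assumes span: "\<And>x. x \<in> V \<Longrightarrow> \<exists>k. x - (\<Sum>i<n. scal (k i) * e i) \<in> local_ideal P F G"
  shows "quot_dim V (local_ideal P F G) \<le> enat n"
  unfolding quot_dim_def
proof (rule SUP_least, clarify)
  fix S assume S: "finite S" "S \<subseteq> V"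
    and indep: "\<forall>c. (\<Sum>s\<in>S. Fract (cst (c s)) 1 * s) \<in> local_ideal P F G \<longrightarrow> (\<forall>s\<in>S. c s = 0)"
  show "enat (card S) \<le> enat n"
  proof (rule ccontr)
    assume "\<not> enat (card S) \<le> enat n"
    then have "n < card S" by simp
    obtain k where k: "s - (\<Sum>i<n. scal (k s i) * e i) \<in> local_ideal P F G" if "s \<in> S" for s
      using span S by (metis subsetD)
    obtain c where c: "\<exists>s\<in>S. c s \<noteq> 0" "\<forall>i<n. (\<Sum>s\<in>S. c s * k s i) = 0"
      using ex_linear_dependency[OF S(1) \<open>n < card S\<close>] by blast
    have "(\<Sum>s\<in>S. scal (c s) * (\<Sum>i<n. scal (k s i) * e i)) = (\<Sum>s\<in>S. \<Sum>i<n. scal (c s * k s i) * e i)"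
      by (simp add: sum_distrib_left mult.assoc)
    also have "\<dots> = (\<Sum>i<n. scal (\<Sum>s\<in>S. c s * k s i) * e i)"
      by (subst sum.swap) (simp add: scal_sum sum_distrib_right)
    also have "\<dots> = 0" using c(2) by simp
    finally have "(\<Sum>s\<in>S. scal (c s) * s) = (\<Sum>s\<in>S. scal (c s) * (s - (\<Sum>i<n. scal (k s i) * e i)))"
      by (simp add: right_diff_distrib sum_subtractf)
    also have "\<dots> \<in> local_ideal P F G"
      using k by (intro local_ideal_sum local_ideal_mult) auto
    finally show False using indep c(1) by (auto simp: scal_def)
  qed
qed

text \<open>Since \<open>F\<close> does not vanish at \<open>P\<close>, the fraction
  \<open>F / F\<close> shows that the ideal contains 1.\<close>

lemma int_mult_eq_0:
  assumes "homogeneous d F" "eval3 F P \<noteq> 0"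
  shows "int_mult P F G = 0"
proof -
  have "1 \<in> local_ideal P F G"
    unfolding One_fract_def using assms by (intro local_idealI[of d 1 F 0 G F]) auto
  then have "x \<in> local_ideal P F G" if "x \<in> local_ring P" for x
    using local_ideal_mult[OF that] by fastforce
  then have "int_mult P F G \<le> enat 0"
    unfolding int_mult_def by (intro quot_dim_local_ideal_le) simp
  then show ?thesis by (simp add: enat_0)
qed

section \<open>Bounds for intersection numbers from arcs and from local parameters\<close>

text \<open>Comparison of lowest orders: once the coefficients before \<open>k i\<close> are zero,
  every term but the \<open>i\<close>-th is divisible by the power \<open>i + 1\<close> of the
  variable, whereas \<open>w i\<close> has nonzero constant term.\<close>

lemma power_series_coeffs_eq_0:
  fixes w :: "nat \<Rightarrow> complex poly"
  assumes eq: "(\<Sum>i<n. smult (k i) ([:0, 1:] ^ i * w i)) = [:0, 1:] ^ n * R"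
    and w: "\<And>i. i < n \<Longrightarrow> poly (w i) 0 \<noteq> 0" and "i < n"
  shows "k i = 0"
  using \<open>i < n\<close>
proof (induction i rule: less_induct)
  case (less i)
  let ?X = "[:0, 1:] :: complex poly"
  let ?t = "\<lambda>j. smult (k j) (?X ^ j * w j)"
  have "?X ^ Suc i dvd ?t j" if "j \<in> {..<n} - {i}" for j
  proof (cases "j < i")
    case True
    then show ?thesis using less.IH that by simp
  next
    case False
    then have "?X ^ Suc i dvd ?X ^ j"
      using that by (intro le_imp_power_dvd) auto
    then show ?thesis by (intro dvd_smult dvd_mult2)
  qed
  then have "?X ^ Suc i dvd (\<Sum>j\<in>{..<n} - {i}. ?t j)"
    by (rule dvd_sum)
  moreover have "?X ^ Suc i dvd ?X ^ n * R"
    using less.prems by (intro dvd_mult2 le_imp_power_dvd) auto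
  moreover have "?t i = ?X ^ n * R - (\<Sum>j\<in>{..<n} - {i}. ?t j)"
    using less.prems by (simp flip: eq add: sum.remove[of "{..<n}" i])
  ultimately have "?X ^ Suc i dvd ?t i"
    by (simp only: dvd_diff)
  then have "?X ^ i * ?X dvd ?X ^ i * smult (k i) (w i)"
    by (simp add: mult.commute)
  then have "?X dvd smult (k i) (w i)"
    by (subst (asm) dvd_times_left_cancel_iff) auto
  then obtain q where "smult (k i) (w i) = ?X * q"
    by (elim dvdE)
  then have "poly (smult (k i) (w i)) 0 = poly (?X * q) 0"
    by (rule arg_cong)
  then show ?case using w less.prems by simp
qed

text \<open>If both curves vanish to order \<open>n\<close> along an arc through \<open>P\<close>, then the powers of a linear
  function that is a local parameter of the arc are independent modulo the two equations.\<close>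

lemma int_mult_ge:
  fixes p1 p2 p3 f g l :: "complex poly"
  assumes P: "P = (poly p1 0, poly p2 0, poly p3 0)"
    and F: "\<And>s. eval3 F (poly p1 s, poly p2 s, poly p3 s) = s ^ n * poly f s"
    and G: "\<And>s. eval3 G (poly p1 s, poly p2 s, poly p3 s) = s ^ n * poly g s"
    and L: "homogeneous 1 L" "\<And>s. eval3 L (poly p1 s, poly p2 s, poly p3 s) = s * poly l s" "poly l 0 \<noteq> 0"
    and M: "homogeneous 1 M" "eval3 M P \<noteq> 0"
  shows "enat n \<le> int_mult P F G"
  unfolding int_mult_def
proof (rule quot_dim_ge[where e = "\<lambda>i. Fract (L ^ i) (M ^ i)"])
  fix i
  show "Fract (L ^ i) (M ^ i) \<in> local_ring P"
    using L M by (intro local_ringI[of i]) (auto intro: homogeneous_power')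
next
  fix k i assume "(\<Sum>i<n. scal (k i) * Fract (L ^ i) (M ^ i)) \<in> local_ideal P F G" and "i < n"
  then obtain U V D where UVD: "(\<Sum>i<n. scal (k i) * Fract (L ^ i) (M ^ i)) = Fract (U * F + V * G) D"
    "eval3 D P \<noteq> 0" "D \<noteq> 0"
    by (elim local_idealE)
  have "M \<noteq> 0" using M by auto
  \<comment> \<open>All powers are brought over the common denominator \<open>M ^ n\<close>, so that
    cross-multiplication leaves an identity of polynomials that can be evaluated along the
    arc.\<close>
  have "scal (k i) * Fract (L ^ i) (M ^ i) = Fract (cst (k i) * L ^ i * M ^ (n - i)) (M ^ n)" if "i < n" for i
  proof -
    have "M ^ n = M ^ (n - i) * M ^ i" using that by (simp flip: power_add)
    then show ?thesis using \<open>M \<noteq> 0\<close> by (simp add: scal_def eq_fract)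
  qed
  then have "Fract (\<Sum>i<n. cst (k i) * L ^ i * M ^ (n - i)) (M ^ n) = Fract (U * F + V * G) D"
    using UVD(1) by (simp add: Fract_sum)
  then have eq: "(\<Sum>i<n. cst (k i) * L ^ i * M ^ (n - i)) * D = (U * F + V * G) * M ^ n"
    using \<open>M \<noteq> 0\<close> UVD(3) by (simp add: eq_fract)
  let ?c = "\<lambda>s. (poly p1 s, poly p2 s, poly p3 s)"
  obtain m where m: "\<And>s. eval3 M (?c s) = poly m s" using eval3_along_curve[of M p1 p2 p3] by metis
  obtain \<delta> where \<delta>: "\<And>s. eval3 D (?c s) = poly \<delta> s" using eval3_along_curve[of D p1 p2 p3] by metis
  obtain u where u: "\<And>s. eval3 U (?c s) = poly u s" using eval3_along_curve[of U p1 p2 p3] by metis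
  obtain v where v: "\<And>s. eval3 V (?c s) = poly v s" using eval3_along_curve[of V p1 p2 p3] by metis
  \<comment> \<open>Collects the factors of the \<open>i\<close>-th term other than
    \<open>s ^ i\<close>. Those coming from \<open>L\<close>, \<open>M\<close> and \<open>D\<close>
    are all nonzero at parameter 0, as the comparison of orders demands.\<close>
  define w where "w i = l ^ i * m ^ (n - i) * \<delta>" for i
  have w0: "poly (w i) 0 \<noteq> 0" for i
    using L(3) M(2) UVD(2) P m[of 0] \<delta>[of 0] by (simp add: w_def)
  have "poly (\<Sum>i<n. smult (k i) ([:0, 1:] ^ i * w i)) s = poly ([:0, 1:] ^ n * ((u * f + v * g) * m ^ n)) s" for s
  proof -
    have "poly (\<Sum>i<n. smult (k i) ([:0, 1:] ^ i * w i)) s =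
        eval3 ((\<Sum>i<n. cst (k i) * L ^ i * M ^ (n - i)) * D) (?c s)"
      unfolding eval3_hom eval3_sum eval3_power L m \<delta>
      by (simp add: poly_sum w_def sum_distrib_left sum_distrib_right power_mult_distrib mult_ac)
    also have "\<dots> = poly ([:0, 1:] ^ n * ((u * f + v * g) * m ^ n)) s"
      unfolding eq eval3_hom eval3_power F G m u v by (simp add: algebra_simps)
    finally show ?thesis .
  qed
  then have "(\<Sum>i<n. smult (k i) ([:0, 1:] ^ i * w i)) = [:0, 1:] ^ n * ((u * f + v * g) * m ^ n)"
    by (intro poly_ext)
  then show "k i = 0"
    using w0 \<open>i < n\<close> by (rule power_series_coeffs_eq_0)
qed simp

text \<open>The hypotheses say that \<open>w\<close> generates the maximal ideal of the local ring modulo the ideal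
  of the two curves.\<close>

lemma int_mult_le:
  assumes M: "homogeneous 1 M" "eval3 M P \<noteq> 0"
    and w: "w \<in> local_ring P"
    and Y: "\<And>Y. Y \<in> {Y1, Y2, Y3} \<Longrightarrow>
      \<exists>c. \<exists>x\<in>local_ring P. Fract Y M - scal c - w * x \<in> local_ideal P F G"
    and wn: "w ^ n \<in> local_ideal P F G"
  shows "int_mult P F G \<le> enat n"
proof -
  let ?O = "local_ring P" and ?W = "local_ideal P F G"
  have "M \<noteq> 0" using M by auto
  \<comment> \<open>\<open>T\<close> consists of the elements that are constant modulo
    \<open>w\<close> and the ideal. It is closed under sums and products and contains the affine
    coordinates, hence all forms over powers of \<open>M\<close>; inverses of denominators remain to
    be treated.\<close>
  define T where "T = {z \<in> ?O. \<exists>c. \<exists>x\<in>?O. z - scal c - w * x \<in> ?W}"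
  have TI: "z \<in> T" if "z \<in> ?O" "x \<in> ?O" "z - scal c - w * x \<in> ?W" for z x c
    using that unfolding T_def by blast
  have T_scal: "scal c \<in> T" for c
    by (rule TI[of _ 0 c]) simp_all
  have T_add: "y + z \<in> T" if yz: "y \<in> T" "z \<in> T" for y z
  proof -
    obtain c x where 1: "y \<in> ?O" "x \<in> ?O" "y - scal c - w * x \<in> ?W" using yz(1) unfolding T_def by blast
    obtain d x' where 2: "z \<in> ?O" "x' \<in> ?O" "z - scal d - w * x' \<in> ?W" using yz(2) unfolding T_def by blast
    show ?thesis
      using local_ideal_add[OF 1(3) 2(3)]
      by (intro TI[of _ "x + x'" "c + d"]) (auto intro: local_ring_add 1 2 simp: algebra_simps)
  qed
  have T_mult: "y * z \<in> T" if yz: "y \<in> T" "z \<in> T" for y z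
  proof -
    obtain c x where 1: "y \<in> ?O" "x \<in> ?O" "y - scal c - w * x \<in> ?W" using yz(1) unfolding T_def by blast
    obtain d x' where 2: "z \<in> ?O" "x' \<in> ?O" "z - scal d - w * x' \<in> ?W" using yz(2) unfolding T_def by blast
    have "scal c * x' + x * z \<in> ?O" by (intro local_ring_add local_ring_mult 1 2) simp
    moreover have "y * z - scal (c * d) - w * (scal c * x' + x * z) =
        z * (y - scal c - w * x) + scal c * (z - scal d - w * x')"
      by (simp add: algebra_simps)
    then have "y * z - scal (c * d) - w * (scal c * x' + x * z) \<in> ?W"
      using 1 2 by (simp only:) (intro local_ideal_add local_ideal_mult, simp_all)
    ultimately show ?thesis
      using 1 2 by (intro TI[of _ "scal c * x' + x * z" "c * d"]) (auto intro: local_ring_mult)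
  qed
  have T_power: "y ^ i \<in> T" if "y \<in> T" for y i
    using that T_scal[of 1] by (induction i) (auto intro: T_mult)
  have T_Y: "Fract Y1 M \<in> T" "Fract Y2 M \<in> T" "Fract Y3 M \<in> T"
    using Y[of Y1] Y[of Y2] Y[of Y3] M unfolding T_def by (auto intro: local_ringI[of "Suc 0"])
  have T_form: "Fract A (M ^ d) \<in> T" if "homogeneous d A" for A d
    using that
  proof (induction rule: homogeneous_induct)
    case zero
    show ?case using T_scal[of 0] by (simp add: fract_collapse)
  next
    case (add A B)
    then show ?case by (simp add: Fract_add_same T_add)
  next
    case (monomial c i j k)
    then have "M ^ d = M ^ k * M ^ j * M ^ i" by (simp add: add_ac flip: power_add)
    then have "Fract (cst c * Y1 ^ k * Y2 ^ j * Y3 ^ i) (M ^ d) =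
        scal c * Fract Y1 M ^ k * Fract Y2 M ^ j * Fract Y3 M ^ i"
      by (simp add: scal_def Fract_power)
    also have "\<dots> \<in> T" by (intro T_mult T_scal T_power T_Y)
    finally show ?case .
  qed
  have T_all: "z \<in> T" if z: "z \<in> ?O" for z
  proof -
    obtain A D d where AD: "z = Fract A D" "homogeneous d A" "homogeneous d D" "eval3 D P \<noteq> 0" "D \<noteq> 0"
      using z by (elim local_ringE)
    define e where "e = Fract (M ^ d) D"
    have e: "e \<in> ?O" and e1: "e * Fract D (M ^ d) = 1"
      using AD M \<open>M \<noteq> 0\<close> by (auto simp: e_def eq_fract One_fract_def intro!: local_ringI homogeneous_power')
    obtain c x where x: "x \<in> ?O" "Fract D (M ^ d) - scal c - w * x \<in> ?W"
      using T_form[OF AD(3)] by (auto simp: T_def)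
    have eW: "1 - e * scal c - e * w * x \<in> ?W"
      using local_ideal_mult[OF e x(2)] e1 by (simp add: algebra_simps)
    \<comment> \<open>The constant \<open>c\<close> has not been tied to the value of
      \<open>D\<close> at \<open>P\<close>, so zero has to be allowed: then 1 is a multiple of
      \<open>w\<close> modulo the ideal, hence so is \<open>e\<close>. Otherwise the congruence is
      solved for \<open>e\<close> by dividing by \<open>c\<close>.\<close>
    have "e \<in> T"
    proof (cases "c = 0")
      case True
      have "e - scal 0 - w * (e * e * x) = e * (1 - e * scal c - e * w * x)"
        using True by (simp add: algebra_simps)
      also have "\<dots> \<in> ?W" by (rule local_ideal_mult[OF e eW])
      finally show ?thesis
        by (rule TI[OF e, rotated]) (intro local_ring_mult e x)+
    next
      case False
      have "e - scal (1 / c) - w * (scal (- 1 / c) * e * x) = scal (- 1 / c) * (1 - e * scal c - e * w * x)"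
        using scal_inverse[OF False] by (simp add: algebra_simps)
      also have "\<dots> \<in> ?W" by (rule local_ideal_mult[OF scal_in_local_ring eW])
      finally show ?thesis
        by (rule TI[OF e, rotated]) (intro local_ring_mult e x scal_in_local_ring)+
    qed
    moreover have "z = Fract A (M ^ d) * e"
      using AD \<open>M \<noteq> 0\<close> by (simp add: e_def eq_fract)
    ultimately show ?thesis using T_form[OF AD(2)] by (simp add: T_mult)
  qed
  \<comment> \<open>Repeated substitution gives a \<open>w\<close>-adic expansion to any order; at
    order \<open>n\<close> the remainder lies in the ideal, so the powers below \<open>n\<close>
    span.\<close>
  have span: "\<exists>k. \<exists>x\<in>?O. z - (\<Sum>i<j. scal (k i) * w ^ i) - w ^ j * x \<in> ?W" if "z \<in> ?O" for z j
  proof (induction j)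
    case 0
    show ?case using that by (intro exI bexI[of _ z]) simp_all
  next
    case (Suc j)
    then obtain k x where x: "x \<in> ?O" "z - (\<Sum>i<j. scal (k i) * w ^ i) - w ^ j * x \<in> ?W" by blast
    obtain c y where y: "y \<in> ?O" "x - scal c - w * y \<in> ?W" using T_all[OF x(1)] by (auto simp: T_def)
    have "z - (\<Sum>i<Suc j. scal ((k(j := c)) i) * w ^ i) - w ^ Suc j * y =
        (z - (\<Sum>i<j. scal (k i) * w ^ i) - w ^ j * x) + w ^ j * (x - scal c - w * y)"
      by (simp add: algebra_simps)
    also have "\<dots> \<in> ?W"
      by (intro local_ideal_add x y local_ideal_mult local_ring_power w)
    finally show ?case using y(1) by blast
  qed
  show ?thesis
    unfolding int_mult_def
  proof (rule quot_dim_local_ideal_le)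
    fix z assume "z \<in> ?O"
    then obtain k x where x: "x \<in> ?O" "z - (\<Sum>i<n. scal (k i) * w ^ i) - w ^ n * x \<in> ?W"
      using span by blast
    have "x * w ^ n \<in> ?W" by (rule local_ideal_mult[OF x(1) wn])
    from local_ideal_add[OF x(2) this]
    have "z - (\<Sum>i<n. scal (k i) * w ^ i) \<in> ?W" by (simp add: algebra_simps)
    then show "\<exists>k. z - (\<Sum>i<n. scal (k i) * w ^ i) \<in> ?W" by blast
  qed
qed

section \<open>Conics through the two points at infinity\<close>

text \<open>The missing squares of \<open>Y2\<close> and \<open>Y3\<close> make the conic pass
  through both points at infinity; the coefficient of \<open>Y2 * Y3\<close> is scaled to 1.\<close>

definition conic_poly :: "complex \<Rightarrow> complex \<Rightarrow> complex \<Rightarrow> poly3" where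
  "conic_poly A B C = cst A * Y1^2 + cst B * Y1 * Y2 + cst C * Y1 * Y3 + Y2 * Y3"

text \<open>Complex parameters cover both signs of \<open>f\<close>: they are real for
  \<open>f > 0\<close> and conjugate to each other for \<open>f < 0\<close>.\<close>

definition conic_pair :: "complex \<Rightarrow> complex \<Rightarrow> poly3" where
  "conic_pair \<alpha> \<beta> = (Y2 * Y3 + cst \<alpha> * Y1^2) * (Y2 * Y3 + cst \<beta> * Y1^2)"

text \<open>Lets the introduction rules compute the degree of an expression before it is compared
  with the expected number.\<close>

lemma homogeneous_conv: "homogeneous d F \<Longrightarrow> d = e \<Longrightarrow> homogeneous e F"
  by simp

lemma homogeneous_add': "homogeneous d F \<Longrightarrow> homogeneous e G \<Longrightarrow> d = e \<Longrightarrow> homogeneous d (F + G)"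
  by auto

lemma homogeneous_diff': "homogeneous d F \<Longrightarrow> homogeneous e G \<Longrightarrow> d = e \<Longrightarrow> homogeneous d (F - G)"
  by auto

lemmas homogeneous_intros = homogeneous_add' homogeneous_diff' homogeneous_minus[THEN iffD2]
  homogeneous_mult homogeneous_power homogeneous_cst homogeneous_Y

lemma homogeneous_linear: "homogeneous (Suc 0) (Y2 - cst c * Y1)"
  by (rule homogeneous_conv) (rule homogeneous_intros | simp)+

lemma homogeneous_conic: "homogeneous 2 (conic_poly A B C)"
  unfolding conic_poly_def by (rule homogeneous_conv) (rule homogeneous_intros | simp)+

lemma homogeneous_conic_pair: "homogeneous 4 (conic_pair \<alpha> \<beta>)"
  unfolding conic_pair_def by (rule homogeneous_conv) (rule homogeneous_intros | simp)+

lemma eval3_conic [simp]: "eval3 (conic_poly A B C) (y1, y2, y3) = A * y1^2 + B * y1 * y2 + C * y1 * y3 + y2 * y3"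
  by (simp add: conic_poly_def)

lemma eval3_conic_pair [simp]:
  "eval3 (conic_pair \<alpha> \<beta>) (y1, y2, y3) = (y2 * y3 + \<alpha> * y1^2) * (y2 * y3 + \<beta> * y1^2)"
  by (simp add: conic_pair_def)

text \<open>Eliminating \<open>x\<close> between the conic and one component \<open>x z + \<alpha> y\<^sup>2\<close> leaves a binary quadratic form
  times \<open>y\<close>. Applied to both components this gives an element of the ideal.\<close>

lemma conic_pair_eliminate:
  fixes x y z A B C \<alpha> \<beta> :: "'a :: comm_ring_1"
  defines "h \<equiv> \<lambda>\<alpha>. C * z^2 + (A - \<alpha>) * y * z - \<alpha> * B * y^2"
  assumes F: "F = A * y^2 + B * y * x + C * y * z + x * z"
  shows "(z + B * y)^2 * ((x * z + \<alpha> * y^2) * (x * z + \<beta> * y^2)) =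
    (z^2 * F - y * z * (h \<alpha> + h \<beta>)) * F + y^2 * h \<alpha> * h \<beta>"
proof -
  have 1: "(z + B * y) * (x * z + \<alpha> * y^2) = z * F - y * h \<alpha>" for \<alpha>
    by (simp add: F h_def algebra_simps power2_eq_square)
  have "(z + B * y)^2 * ((x * z + \<alpha> * y^2) * (x * z + \<beta> * y^2)) =
      ((z + B * y) * (x * z + \<alpha> * y^2)) * ((z + B * y) * (x * z + \<beta> * y^2))"
    by (simp only: power2_eq_square mult_ac)
  also have "\<dots> = (z^2 * F - y * z * (h \<alpha> + h \<beta>)) * F + y^2 * h \<alpha> * h \<beta>"
    unfolding 1 by (simp add: algebra_simps power2_eq_square)
  finally show ?thesis .
qed

lemma Fract_self: "b \<noteq> 0 \<Longrightarrow> Fract b b = 1" for b :: "'a :: idom"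
  unfolding One_fract_def by (subst eq_fract) simp_all

text \<open>Brings the congruence demanded by \<open>int_mult_le\<close> over one denominator, after
  which it is a polynomial identity for the numerator.\<close>

lemma Fract_combine:
  assumes "M \<noteq> 0" "N \<noteq> 0"
  shows "Fract V M - scal c - Fract L M * Fract K N = Fract ((V - cst c * M) * N - L * K) (M * N)"
proof -
  have "scal c = Fract (cst c * M * N) (M * N)"
    using assms by (simp add: scal_def eq_fract)
  moreover have "Fract V M = Fract (V * N) (M * N)"
    using assms by (simp add: eq_fract)
  moreover have "Fract (V * N - cst c * M * N - L * K) (M * N) =
      Fract (V * N) (M * N) - Fract (cst c * M * N) (M * N) - Fract (L * K) (M * N)"
    using Fract_add_same[of "V * N - cst c * M * N - L * K" "L * K" "M * N"]
      Fract_add_same[of "V * N - cst c * M * N" "cst c * M * N" "M * N"] by simp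
  ultimately show ?thesis by (simp add: left_diff_distrib)
qed

text \<open>\<open>X\<close> and \<open>Z\<close> are kept abstract so that exchanging
  \<open>Y2\<close> and \<open>Y3\<close> serves the other point. Near \<open>P\<close> the conic
  can be solved for \<open>X\<close>, so \<open>Y1 / Z\<close> is a parameter; elimination puts
  \<open>Y1^2 * h \<alpha> * h \<beta>\<close> into the ideal, and both values of \<open>h\<close>
  equal \<open>C\<close> at \<open>P\<close>.\<close>

lemma int_mult_at_infinity_le:
  assumes X: "homogeneous (Suc 0) X" "eval3 X P = 0" and Z: "homogeneous (Suc 0) Z" "eval3 Z P = 1"
    and Y: "eval3 Y1 P = 0" "{Y1, Y2, Y3} = {Y1, X, Z}"
    and F: "F = cst A * Y1^2 + cst B * Y1 * X + cst C * Y1 * Z + X * Z"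
    and G: "G = (X * Z + cst \<alpha> * Y1^2) * (X * Z + cst \<beta> * Y1^2)" and C: "C \<noteq> 0"
  shows "int_mult P F G \<le> 2"
proof -
  have "Z \<noteq> 0" using Z by auto
  define h where "h \<alpha> = cst C * Z^2 + cst (A - \<alpha>) * Y1 * Z - cst \<alpha> * cst B * Y1^2" for \<alpha>
  \<comment> \<open>The coefficient of \<open>X\<close> in \<open>F\<close>: dividing by it solves
    the conic for \<open>X\<close>, and it equals 1 at \<open>P\<close>.\<close>
  define N where "N = Z + cst B * Y1"
  have lin: "homogeneous (Suc 0) N" "homogeneous (Suc 0) (cst c * Y1)" "homogeneous (Suc 0) (cst c * Z)" for c
    unfolding N_def by (rule homogeneous_conv, (rule homogeneous_intros Z(1) | simp)+)+
  have N: "eval3 N P = 1" "N \<noteq> 0"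
    using Z Y by (auto simp: N_def dest: arg_cong[of _ 0 "\<lambda>F. eval3 F P"])
  have hF: "homogeneous 2 F"
    unfolding F by (rule homogeneous_conv) (rule homogeneous_intros X(1) Z(1) | simp)+
  have hG: "homogeneous 4 G"
    unfolding G by (rule homogeneous_conv) (rule homogeneous_intros X(1) Z(1) | simp)+
  have hh: "homogeneous 2 (h \<alpha>)" for \<alpha>
    unfolding h_def by (rule homogeneous_conv) (rule homogeneous_intros Z(1) | simp)+
  have h1: "eval3 (h \<alpha>) P = C" for \<alpha>
    using Y Z by (simp add: h_def)
  have "int_mult P F G \<le> enat 2"
  proof (rule int_mult_le[of Z P "Fract Y1 Z"])
    show "homogeneous 1 Z" "eval3 Z P \<noteq> 0" "Fract Y1 Z \<in> local_ring P"
      using Z by (auto intro: local_ringI[of "Suc 0"])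
  next
    fix V assume "V \<in> {Y1, Y2, Y3}"
    then consider "V = Y1" | "V = X" | "V = Z" using Y by blast
    then show "\<exists>c. \<exists>x\<in>local_ring P. Fract V Z - scal c - Fract Y1 Z * x \<in> local_ideal P F G"
    proof cases
      case 1
      then show ?thesis by (intro exI[of _ 0] bexI[of _ 1]) simp_all
    next
      case 2
      have K: "Fract (- (cst C * Z + cst A * Y1)) N \<in> local_ring P"
        using N lin by (intro local_ringI[of "Suc 0"]) (auto intro: homogeneous_add)
      have "Fract V Z - scal 0 - Fract Y1 Z * Fract (- (cst C * Z + cst A * Y1)) N = Fract F (Z * N)"
        unfolding Fract_combine[OF \<open>Z \<noteq> 0\<close> N(2)]
        by (simp add: 2 F N_def algebra_simps power2_eq_square)
      also have "\<dots> \<in> local_ideal P F G"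
        using \<open>Z \<noteq> 0\<close> N Z hF lin
        by (intro local_idealI[of 2 1 F 0 G "Z * N"]) (auto intro: homogeneous_mult')
      finally show ?thesis
        using K by blast
    next
      case 3
      have "Fract V Z - scal 1 - Fract Y1 Z * 0 = 0"
        using \<open>Z \<noteq> 0\<close> by (simp add: 3 Fract_self)
      then show ?thesis
        using local_ideal_0 local_ring_0 by (intro exI[of _ 1] bexI[of _ 0]) (simp_all only:)
    qed
  next
    have elim: "N^2 * G = (Z^2 * F - Y1 * Z * (h \<alpha> + h \<beta>)) * F + Y1^2 * h \<alpha> * h \<beta>"
      using conic_pair_eliminate[of F "cst A" Y1 "cst B" X "cst C" Z "cst \<alpha>" "cst \<beta>"]
      unfolding G h_def N_def cst_hom by (simp only: F)
    have "homogeneous 6 ((- (Z^2 * F - Y1 * Z * (h \<alpha> + h \<beta>))) * F)"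
      by (rule homogeneous_conv) (rule homogeneous_intros hF hh Z(1) | simp)+
    moreover have "homogeneous 6 (N^2 * G)"
      by (rule homogeneous_conv) (rule homogeneous_intros hG lin(1) | simp)+
    moreover have "homogeneous 6 (Z^2 * (h \<alpha> * h \<beta>))"
      by (rule homogeneous_conv) (rule homogeneous_intros hh Z(1) | simp)+
    moreover have "eval3 (Z^2 * (h \<alpha> * h \<beta>)) P \<noteq> 0"
      using C h1 Z by simp
    moreover have "Y1^2 * (Z^2 * (h \<alpha> * h \<beta>)) =
        ((- (Z^2 * F - Y1 * Z * (h \<alpha> + h \<beta>))) * F + N^2 * G) * Z^2"
      unfolding elim by (simp add: algebra_simps)
    moreover have "Z^2 \<noteq> 0" using \<open>Z \<noteq> 0\<close> by simp
    ultimately show "Fract Y1 Z ^ 2 \<in> local_ideal P F G"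
      unfolding Fract_power by (rule local_idealI)
  qed
  then show ?thesis by (simp add: numeral_eq_enat)
qed

lemma int_mult_infinity1_le: "C \<noteq> 0 \<Longrightarrow> int_mult (0, 0, 1) (conic_poly A B C) (conic_pair \<alpha> \<beta>) \<le> 2"
  by (rule int_mult_at_infinity_le[of Y2 _ Y3 _ A B C _ \<alpha> \<beta>]) (simp_all add: conic_poly_def conic_pair_def)

lemma int_mult_infinity2_le: "B \<noteq> 0 \<Longrightarrow> int_mult (0, 1, 0) (conic_poly A B C) (conic_pair \<alpha> \<beta>) \<le> 2"
  by (rule int_mult_at_infinity_le[of Y3 _ Y2 _ A C B _ \<alpha> \<beta>])
    (simp_all add: conic_poly_def conic_pair_def mult.commute[of Y3 Y2] insert_commute[of Y3 Y2])

text \<open>\<open>sum\<close> and \<open>prod\<close> make \<open>u\<close> and \<open>u'\<close>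
  the roots of the quadratic left by eliminating \<open>y3\<close> between the conic and the
  \<alpha>-component. As \<open>u\<close> is simple and the quadratic of the \<beta>-component is
  nonzero there, \<open>y2 - u * y1\<close> times a unit lies in the ideal.\<close>

lemma int_mult_transversal_le:
  assumes B: "B \<noteq> 0" and "u + C \<noteq> 0" "u \<noteq> u'"
    and sum: "B * (u + u') = \<alpha> - A" and prod: "B * u * u' = - \<alpha> * C"
    and h\<beta>: "B * u^2 + (A - \<beta>) * u - \<beta> * C \<noteq> 0"
    and P: "A + B * u + C * v + u * v = 0"
  shows "int_mult (1, u, v) (conic_poly A B C) (conic_pair \<alpha> \<beta>) \<le> 1"
proof -
  let ?P = "(1 :: complex, u, v)" and ?F = "conic_poly A B C" and ?G = "conic_pair \<alpha> \<beta>"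
  have "Y1 \<noteq> 0" by (simp add: Y1_def)
  define N where "N = Y2 + cst C * Y1"
  have "homogeneous (Suc 0) N"
    unfolding N_def by (rule homogeneous_conv) (rule homogeneous_intros | simp)+
  then have N: "eval3 N ?P \<noteq> 0" "homogeneous (Suc 0) N"
    using \<open>u + C \<noteq> 0\<close> by (simp_all add: N_def)
  then have "N \<noteq> 0" by auto
  define h where "h \<alpha> = cst B * Y2^2 + cst (A - \<alpha>) * Y1 * Y2 - cst \<alpha> * cst C * Y1^2" for \<alpha>
  have hh: "homogeneous 2 (h \<alpha>)" for \<alpha>
    unfolding h_def by (rule homogeneous_conv) (rule homogeneous_intros | simp)+
  have "A - \<alpha> = - (B * (u + u'))" "\<alpha> * C = - (B * u * u')"
    using sum prod by simp_all
  then have "h \<alpha> = cst B * Y2^2 + cst (- (B * (u + u'))) * Y1 * Y2 - cst (- (B * u * u')) * Y1^2"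
    unfolding h_def cst_hom(2)[symmetric] by simp
  also have "\<dots> = cst B * (Y2 - cst u * Y1) * (Y2 - cst u' * Y1)"
    by (simp add: algebra_simps power2_eq_square)
  finally have "h \<alpha> = cst B * (Y2 - cst u * Y1) * (Y2 - cst u' * Y1)" .
  then have h\<alpha>: "(Y2 - cst u * Y1) * (cst B * (Y2 - cst u' * Y1)) = h \<alpha>"
    by (simp add: mult_ac)
  have "int_mult ?P ?F ?G \<le> enat 1"
  proof (rule int_mult_le[of Y1 _ "Fract (Y2 - cst u * Y1) Y1"])
    show "homogeneous 1 Y1" "eval3 Y1 ?P \<noteq> 0" by simp_all
    show "Fract (Y2 - cst u * Y1) Y1 \<in> local_ring ?P"
      by (rule local_ringI[of "Suc 0"]) (simp_all add: homogeneous_linear)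
  next
    fix V assume "V \<in> {Y1, Y2, Y3}"
    then consider "V = Y1" | "V = Y2" | "V = Y3" by blast
    then show "\<exists>c. \<exists>x\<in>local_ring ?P. Fract V Y1 - scal c - Fract (Y2 - cst u * Y1) Y1 * x \<in> local_ideal ?P ?F ?G"
    proof cases
      case 1
      have "Fract V Y1 - scal 1 - Fract (Y2 - cst u * Y1) Y1 * 0 = 0"
        using \<open>Y1 \<noteq> 0\<close> by (simp add: 1 Fract_self)
      then show ?thesis
        using local_ideal_0 local_ring_0 by (intro exI[of _ 1] bexI[of _ 0]) (simp_all only:)
    next
      case 2
      have "Fract V Y1 - scal u - Fract (Y2 - cst u * Y1) Y1 * Fract 1 1 = Fract 0 (Y1 * 1)"
        unfolding Fract_combine[OF \<open>Y1 \<noteq> 0\<close> one_neq_zero] by (simp add: 2)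
      also have "\<dots> = 0" by (simp add: fract_collapse)
      finally show ?thesis
        using local_ideal_0 by (intro exI[of _ u] bexI[of _ "Fract 1 1"]) (simp_all only: One_fract_def[symmetric] local_ring_1)
    next
      case 3
      \<comment> \<open>As the point lies on the conic, the equation can be written
        \<open>(Y3 - v * Y1) * N + (B + v) * Y1 * (Y2 - u * Y1)\<close>; modulo the ideal this makes
        \<open>Y3 / Y1 - v\<close> a multiple of the parameter.\<close>
      have K: "Fract (- (cst (B + v) * Y1)) N \<in> local_ring ?P"
        using N by (intro local_ringI[of "Suc 0"]) (auto intro: homogeneous_cst_mult simp del: cst_hom)
      have "cst (A + B * u + C * v + u * v) = cst 0" using P by simp
      then have A: "cst A = - (cst B * cst u + cst C * cst v + cst u * cst v)"
        by (simp add: eq_neg_iff_add_eq_0 algebra_simps)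
      have "(V - cst v * Y1) * N - (Y2 - cst u * Y1) * - (cst (B + v) * Y1) = ?F"
        by (simp only: conic_poly_def A 3 N_def) (simp add: algebra_simps power2_eq_square)
      then have "Fract V Y1 - scal v - Fract (Y2 - cst u * Y1) Y1 * Fract (- (cst (B + v) * Y1)) N = Fract ?F (Y1 * N)"
        unfolding Fract_combine[OF \<open>Y1 \<noteq> 0\<close> \<open>N \<noteq> 0\<close>] by (rule arg_cong)
      also have "\<dots> \<in> local_ideal ?P ?F ?G"
        using \<open>Y1 \<noteq> 0\<close> \<open>N \<noteq> 0\<close> N
        by (intro local_idealI[of 2 1 ?F 0 ?G "Y1 * N"]) (simp_all add: homogeneous_conic homogeneous_mult'[of "Suc 0" _ "Suc 0"])
      finally show ?thesis
        using K by blast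
    qed
  next
    have elim: "N^2 * ?G = (Y2^2 * ?F - Y1 * Y2 * (h \<alpha> + h \<beta>)) * ?F + Y1^2 * h \<alpha> * h \<beta>"
      using conic_pair_eliminate[of ?F "cst A" Y1 "cst C" Y3 "cst B" Y2 "cst \<alpha>" "cst \<beta>"]
      unfolding conic_pair_def h_def N_def cst_hom by (simp only: conic_poly_def mult.commute[of Y3 Y2] add_ac)
    have "homogeneous 6 ((- (Y2^2 * ?F - Y1 * Y2 * (h \<alpha> + h \<beta>))) * ?F)"
      by (rule homogeneous_conv) (rule homogeneous_intros homogeneous_conic hh | simp)+
    moreover have "homogeneous 6 (N^2 * ?G)"
      by (rule homogeneous_conv) (rule homogeneous_intros homogeneous_conic_pair N(2) | simp)+
    moreover have "homogeneous 6 (Y1^3 * (cst B * (Y2 - cst u' * Y1)) * h \<beta>)"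
      by (rule homogeneous_conv) (rule homogeneous_intros hh | simp)+
    moreover have "eval3 (Y1^3 * (cst B * (Y2 - cst u' * Y1)) * h \<beta>) ?P \<noteq> 0"
      using B \<open>u \<noteq> u'\<close> h\<beta> by (simp add: h_def)
    moreover have "(Y2 - cst u * Y1) * (Y1^3 * (cst B * (Y2 - cst u' * Y1)) * h \<beta>) = Y1^3 * h \<alpha> * h \<beta>"
      by (simp only: flip: h\<alpha>) (simp only: mult_ac)
    then have "(Y2 - cst u * Y1) * (Y1^3 * (cst B * (Y2 - cst u' * Y1)) * h \<beta>) =
        ((- (Y2^2 * ?F - Y1 * Y2 * (h \<alpha> + h \<beta>))) * ?F + N^2 * ?G) * Y1"
      unfolding elim by (simp add: power3_eq_cube power2_eq_square algebra_simps)
    ultimately show "Fract (Y2 - cst u * Y1) Y1 ^ 1 \<in> local_ideal ?P ?F ?G"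
      unfolding power_one_right using \<open>Y1 \<noteq> 0\<close> by (rule local_idealI)
  qed
  then show ?thesis by (simp add: one_enat_def)
qed

section \<open>Lower bounds at the points where conic and quartic meet\<close>

text \<open>The arc parametrises the conic itself by \<open>s = y1 / y3\<close>, with the
  denominator \<open>1 + B * s\<close> cleared; hence the conic restricts to 0 and each component of
  the quartic contributes a factor \<open>s\<close>. The scale \<open>z\<close> reaches every
  representative of the point, as the touching condition ranges over all of them.\<close>

lemma int_mult_infinity1_ge:
  assumes "z \<noteq> 0"
  shows "2 \<le> int_mult (0, 0, z) (conic_poly A B C) (conic_pair \<alpha> \<beta>)"
proof -
  have "enat 2 \<le> int_mult (0, 0, z) (conic_poly A B C) (conic_pair \<alpha> \<beta>)"
  proof (rule int_mult_ge[of _ "smult z [:0, 1, B:]" "smult z [:0, - C, - A:]" "smult z [:1, B:]"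
        _ _ 0 _ "smult (z^4) ([:1, B:]^2 * ([:- C, \<alpha> - A, \<alpha> * B:] * [:- C, \<beta> - A, \<beta> * B:]))"
        Y1 "smult z [:1, B:]" Y3])
    fix s
    show "eval3 (conic_poly A B C) (poly (smult z [:0, 1, B:]) s, poly (smult z [:0, - C, - A:]) s, poly (smult z [:1, B:]) s) =
        s ^ 2 * poly 0 s"
      by (simp add: algebra_simps power2_eq_square)
    have "poly (smult z [:0, - C, - A:]) s * poly (smult z [:1, B:]) s + c * poly (smult z [:0, 1, B:]) s ^ 2 =
        z^2 * (s * ((1 + B * s) * poly [:- C, c - A, c * B:] s))" for c
      by (simp add: algebra_simps power2_eq_square)
    then show "eval3 (conic_pair \<alpha> \<beta>) (poly (smult z [:0, 1, B:]) s, poly (smult z [:0, - C, - A:]) s, poly (smult z [:1, B:]) s) =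
        s ^ 2 * poly (smult (z^4) ([:1, B:]^2 * ([:- C, \<alpha> - A, \<alpha> * B:] * [:- C, \<beta> - A, \<beta> * B:]))) s"
      by (simp only: eval3_conic_pair poly_mult poly_power poly_smult)
        (simp add: power2_eq_square power4_eq_xxxx mult_ac)
  qed (use assms in \<open>simp_all add: algebra_simps\<close>)
  then show ?thesis by (simp add: numeral_eq_enat)
qed

lemma int_mult_infinity2_ge:
  assumes "z \<noteq> 0"
  shows "2 \<le> int_mult (0, z, 0) (conic_poly A B C) (conic_pair \<alpha> \<beta>)"
proof -
  have "enat 2 \<le> int_mult (0, z, 0) (conic_poly A B C) (conic_pair \<alpha> \<beta>)"
  proof (rule int_mult_ge[of _ "smult z [:0, 1, C:]" "smult z [:1, C:]" "smult z [:0, - B, - A:]"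
        _ _ 0 _ "smult (z^4) ([:1, C:]^2 * ([:- B, \<alpha> - A, \<alpha> * C:] * [:- B, \<beta> - A, \<beta> * C:]))"
        Y1 "smult z [:1, C:]" Y2])
    fix s
    show "eval3 (conic_poly A B C) (poly (smult z [:0, 1, C:]) s, poly (smult z [:1, C:]) s, poly (smult z [:0, - B, - A:]) s) =
        s ^ 2 * poly 0 s"
      by (simp add: algebra_simps power2_eq_square)
    have "poly (smult z [:1, C:]) s * poly (smult z [:0, - B, - A:]) s + c * poly (smult z [:0, 1, C:]) s ^ 2 =
        z^2 * (s * ((1 + C * s) * poly [:- B, c - A, c * C:] s))" for c
      by (simp add: algebra_simps power2_eq_square)
    then show "eval3 (conic_pair \<alpha> \<beta>) (poly (smult z [:0, 1, C:]) s, poly (smult z [:1, C:]) s, poly (smult z [:0, - B, - A:]) s) =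
        s ^ 2 * poly (smult (z^4) ([:1, C:]^2 * ([:- B, \<alpha> - A, \<alpha> * C:] * [:- B, \<beta> - A, \<beta> * C:]))) s"
      by (simp only: eval3_conic_pair poly_mult poly_power poly_smult)
        (simp add: power2_eq_square power4_eq_xxxx mult_ac)
  qed (use assms in \<open>simp_all add: algebra_simps\<close>)
  then show ?thesis by (simp add: numeral_eq_enat)
qed

text \<open>For \<open>C = 0\<close> each component vanishes to order two along the same arc; three
  of the four factors \<open>s\<close> already rule out the value 2 of special type.\<close>

lemma int_mult_infinity1_tangent_ge:
  "3 \<le> int_mult (0, 0, 1) (conic_poly A B 0) (conic_pair \<alpha> \<beta>)"
proof -
  have "enat 3 \<le> int_mult (0, 0, 1) (conic_poly A B 0) (conic_pair \<alpha> \<beta>)"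
  proof (rule int_mult_ge[of _ "[:0, 1, B:]" "[:0, 0, - A:]" "[:1, B:]"
        _ _ 0 _ "[:0, 1:] * ([:1, B:]^2 * ([:\<alpha> - A, \<alpha> * B:] * [:\<beta> - A, \<beta> * B:]))"
        Y1 "[:1, B:]" Y3])
    fix s
    show "eval3 (conic_poly A B 0) (poly [:0, 1, B:] s, poly [:0, 0, - A:] s, poly [:1, B:] s) = s ^ 3 * poly 0 s"
      by (simp add: algebra_simps power2_eq_square)
    have "poly [:0, 0, - A:] s * poly [:1, B:] s + c * poly [:0, 1, B:] s ^ 2 =
        s^2 * ((1 + B * s) * poly [:c - A, c * B:] s)" for c
      by (simp add: algebra_simps power2_eq_square)
    then show "eval3 (conic_pair \<alpha> \<beta>) (poly [:0, 1, B:] s, poly [:0, 0, - A:] s, poly [:1, B:] s) =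
        s ^ 3 * poly ([:0, 1:] * ([:1, B:]^2 * ([:\<alpha> - A, \<alpha> * B:] * [:\<beta> - A, \<beta> * B:]))) s"
      by (simp only: eval3_conic_pair poly_mult poly_power)
        (simp add: power2_eq_square power3_eq_cube mult_ac)
  qed (simp_all add: algebra_simps)
  then show ?thesis by (simp add: numeral_eq_enat)
qed

text \<open>The first hypothesis says that \<open>u\<close> is a double root. Along the
  parametrisation of the conic by \<open>s = y2 / y1 - u\<close> the \<alpha>-component therefore
  vanishes to order two.\<close>

lemma int_mult_touching_ge:
  assumes \<alpha>: "\<And>s. B * s^2 + (A - \<alpha>) * s - \<alpha> * C = B * (s - u)^2"
    and F: "eval3 (conic_poly A B C) (y1, y2, y3) = 0" and "A \<noteq> B * C" and "y1 \<noteq> 0" "y2 = u * y1"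
  shows "2 \<le> int_mult (y1, y2, y3) (conic_poly A B C) (conic_pair \<alpha> \<beta>)"
proof -
  have F': "(A + B * u) * y1 + y3 * (C + u) = 0"
  proof -
    have "y1 * ((A + B * u) * y1 + y3 * (C + u)) = 0"
      using F by (simp add: \<open>y2 = u * y1\<close> algebra_simps power2_eq_square)
    then show ?thesis using \<open>y1 \<noteq> 0\<close> by simp
  qed
  have "C + u \<noteq> 0"
  proof
    assume "C + u = 0"
    then have "u = - C" by (simp add: eq_neg_iff_add_eq_0 add.commute)
    then show False using F' \<open>y1 \<noteq> 0\<close> \<open>A \<noteq> B * C\<close> by simp
  qed
  \<comment> \<open>The scale at which the arc passes through the given representative for
    \<open>s = 0\<close>.\<close>
  define k where "k = y1 / (C + u)"
  have y: "y1 = k * (C + u)" "y2 = k * (u * (C + u))" "y3 = k * (- (A + B * u))"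
    using \<open>C + u \<noteq> 0\<close> \<open>y2 = u * y1\<close> F' by (simp_all add: k_def field_simps) (simp add: eq_neg_iff_add_eq_0 algebra_simps)
  define p1 p2 p3 where "p1 = smult k [:C + u, 1:]" and "p2 = smult k ([:u, 1:] * [:C + u, 1:])"
    and "p3 = smult k [:- (A + B * u), - B:]"
  have p: "poly p1 s = k * (C + u + s)" "poly p2 s = k * ((u + s) * (C + u + s))"
    "poly p3 s = k * (- (A + B * (u + s)))" for s
    by (simp_all add: p1_def p2_def p3_def algebra_simps)
  have "enat 2 \<le> int_mult (y1, y2, y3) (conic_poly A B C) (conic_pair \<alpha> \<beta>)"
  proof (rule int_mult_ge[of _ p1 p2 p3 _ _ 0 _ "smult (- B * k^2) ([:C + u, 1:] * (p2 * p3 + smult \<beta> (p1^2)))"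
        "Y2 - cst u * Y1" p1 Y1])
    fix s
    show "eval3 (conic_poly A B C) (poly p1 s, poly p2 s, poly p3 s) = s ^ 2 * poly 0 s"
      unfolding p by (simp add: algebra_simps power2_eq_square)
    have "poly p2 s * poly p3 s + \<alpha> * poly p1 s ^ 2 =
        - (k^2) * (C + u + s) * (B * (s + u)^2 + (A - \<alpha>) * (s + u) - \<alpha> * C)"
      unfolding p by (simp add: algebra_simps power2_eq_square)
    also have "\<dots> = - (k^2) * (C + u + s) * (B * s^2)"
      unfolding \<alpha> by simp
    finally have 1: "poly p2 s * poly p3 s + \<alpha> * poly p1 s ^ 2 = - (k^2) * (C + u + s) * (B * s^2)" .
    show "eval3 (conic_pair \<alpha> \<beta>) (poly p1 s, poly p2 s, poly p3 s) =
        s ^ 2 * poly (smult (- B * k^2) ([:C + u, 1:] * (p2 * p3 + smult \<beta> (p1^2)))) s"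
      unfolding eval3_conic_pair 1 by (simp add: algebra_simps)
    show "eval3 (Y2 - cst u * Y1) (poly p1 s, poly p2 s, poly p3 s) = s * poly p1 s"
      by (simp add: p algebra_simps)
    show "homogeneous 1 (Y2 - cst u * Y1)"
      by (simp add: homogeneous_linear)
  qed (use \<open>y1 \<noteq> 0\<close> in \<open>simp_all add: p y\<close>)
  then show ?thesis by (simp add: numeral_eq_enat)
qed

section \<open>Real structure and touching conics\<close>

lemma eval3_scale:
  assumes "homogeneous d F"
  shows "eval3 F (c * y1, c * y2, c * y3) = c ^ d * eval3 F (y1, y2, y3)"
  using assms
proof (induction rule: homogeneous_induct)
  case (monomial a i j k)
  then show ?case by (auto simp: power_mult_distrib power_add)
qed (simp_all add: distrib_left)

lemma plane_pt_in_plane_locus: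
  assumes F: "homogeneous d F" and y: "y \<noteq> (0, 0, 0)"
  shows "plane_pt t y \<in> plane_locus t F \<longleftrightarrow> eval3 F y = 0"
proof
  assume "plane_pt t y \<in> plane_locus t F"
  then obtain z where z: "plane_pt t y = plane_pt t z" "z \<noteq> (0, 0, 0)" "eval3 F z = 0"
    by (auto simp: plane_locus_def)
  obtain y1 y2 y3 z1 z2 z3 where yz: "y = (y1, y2, y3)" "z = (z1, z2, z3)"
    by (cases y, cases z)
  have nz: "(of_real t * z1, z1, z2, z3) \<noteq> (0, 0, 0, 0)" "(of_real t * y1, y1, y2, y3) \<noteq> (0, 0, 0, 0)"
    using y z(2) yz by auto
  have "pt (of_real t * z1) z1 z2 z3 = pt (of_real t * y1) y1 y2 y3"
    using z(1) by (simp add: plane_pt_def yz)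
  then obtain c where "y1 = c * z1" "y2 = c * z2" "y3 = c * z3"
    unfolding pt_eq_iff[OF nz] by blast
  then show "eval3 F y = 0"
    using z(3) by (simp add: yz eval3_scale[OF F])
next
  assume "eval3 F y = 0"
  then show "plane_pt t y \<in> plane_locus t F"
    using y unfolding plane_locus_def by blast
qed

text \<open>Prescribing \<alpha> and \<beta> by sum and product avoids choosing a square root of the
  cubic and covers both of its signs.\<close>

lemma quartic_curve_eq_conic_pair:
  assumes "\<alpha> + \<beta> = 2 * of_real (qform Q t 1)" "\<alpha> * \<beta> = of_real ((qform Q t 1)^2 - cubic a b t)"
  shows "quartic_curve a b Q t = conic_pair \<alpha> \<beta>"
proof -
  have "quartic_curve a b Q t = (Y2 * Y3)^2 + cst (2 * of_real (qform Q t 1)) * Y1^2 * (Y2 * Y3)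
      + cst (of_real ((qform Q t 1)^2 - cubic a b t)) * Y1^4"
  proof -
    have "cst 2 = 1 + 1"
      using cst_hom(1)[of 1 1] by simp
    then show ?thesis
      by (simp add: quartic_curve_def power2_eq_square power4_eq_xxxx algebra_simps)
  qed
  also have "\<dots> = conic_pair \<alpha> \<beta>"
    unfolding assms[symmetric] by (simp add: conic_pair_def power2_eq_square power4_eq_xxxx algebra_simps)
  finally show ?thesis .
qed

lemma plane_pt_in_quartic_surface:
  assumes "\<alpha> + \<beta> = 2 * of_real (qform Q t 1)" "\<alpha> * \<beta> = of_real ((qform Q t 1)^2 - cubic a b t)"
    and "y \<noteq> (0, 0, 0)"
  shows "plane_pt t y \<in> quartic_surface a b Q \<longleftrightarrow> eval3 (conic_pair \<alpha> \<beta>) y = 0"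
proof -
  obtain y1 y2 y3 where y: "y = (y1, y2, y3)" by (cases y)
  have "plane_pt t y \<in> {pt y0 y1 y2 y3 | y0 y1 y2 y3. (y0, y1, y2, y3) \<noteq> (0, 0, 0, 0) \<and> y0 = of_real t * y1}"
    using assms(3) by (force simp: plane_pt_def y)
  then have "plane_pt t y \<in> quartic_surface a b Q \<longleftrightarrow> plane_pt t y \<in> plane_locus t (quartic_curve a b Q t)"
    unfolding plane_locus_quartic_curve by blast
  also have "\<dots> \<longleftrightarrow> eval3 (conic_pair \<alpha> \<beta>) y = 0"
    unfolding quartic_curve_eq_conic_pair[OF assms(1,2)]
    by (rule plane_pt_in_plane_locus[OF homogeneous_conic_pair assms(3)])
  finally show ?thesis .
qed

lemma cp3_sigma_plane_pt:
  assumes "(y1, y2, y3) \<noteq> (0, 0, 0)"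
  shows "cp3_sigma (plane_pt t (y1, y2, y3)) = plane_pt t (cnj y1, cnj y3, cnj y2)"
  unfolding plane_pt_def prod.case using assms by (subst cp3_sigma_pt) auto

text \<open>Reality is known for the zero set only. A point \<open>(1, cnj z, w)\<close> of the
  conic is sent to \<open>(1, cnj w, z)\<close>; eliminating \<open>w\<close> from the two
  conditions gives the polynomial \<open>p\<close> in \<open>z\<close> with infinitely many zeros,
  so its coefficients vanish.\<close>

lemma real_conic_coeffs:
  assumes "cp3_sigma ` plane_locus t (conic_poly A B C) = plane_locus t (conic_poly A B C)"
  shows "C = cnj B" "A \<in> \<real>"
proof -
  define p where "p = [:A * cnj C - B * cnj A, A - B * cnj B + C * cnj C - cnj A, C - cnj B:]"
  have "poly p z = 0" if "z \<noteq> - cnj C" for z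
  proof -
    have nz: "C + cnj z \<noteq> 0"
      using that by (metis add_eq_0_iff complex_cnj_cnj complex_cnj_minus)
    define w where "w = - (A + B * cnj z) / (C + cnj z)"
    have w: "w * (C + cnj z) = - (A + B * cnj z)" using nz by (simp add: w_def)
    have "eval3 (conic_poly A B C) (1, cnj z, w) = 0"
      using w by (simp add: algebra_simps)
    then have "plane_pt t (1, cnj z, w) \<in> plane_locus t (conic_poly A B C)"
      by (subst plane_pt_in_plane_locus[OF homogeneous_conic]) auto
    then have "cp3_sigma (plane_pt t (1, cnj z, w)) \<in> plane_locus t (conic_poly A B C)"
      using assms by blast
    then have "eval3 (conic_poly A B C) (1, cnj w, z) = 0"
      by (simp add: cp3_sigma_plane_pt plane_pt_in_plane_locus[OF homogeneous_conic] del: eval3_conic)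
    moreover have "(cnj C + z) * (A + C * z) + (B + z) * (cnj w * (cnj C + z)) =
        (cnj C + z) * eval3 (conic_poly A B C) (1, cnj w, z)"
      by (simp add: algebra_simps)
    ultimately have eq: "(cnj C + z) * (A + C * z) + (B + z) * (cnj w * (cnj C + z)) = 0"
      by simp
    have "cnj w * (cnj C + z) = - (cnj A + cnj B * z)"
      using arg_cong[OF w, of cnj] by simp
    then have "(cnj C + z) * (A + C * z) - (B + z) * (cnj A + cnj B * z) = 0"
      using eq by (simp only: mult_minus_right diff_conv_add_uminus)
    then show ?thesis
      by (simp add: p_def algebra_simps)
  qed
  then have "- {- cnj C} \<subseteq> {z. poly p z = 0}" by blast
  moreover have "infinite (- {- cnj C})"
    by (simp add: infinite_UNIV_char_0)
  ultimately have "p = 0"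
    using poly_roots_finite[of p] finite_subset by blast
  \<comment> \<open>The leading coefficient gives \<open>C = cnj B\<close>, after which the linear
    one reduces to \<open>A = cnj A\<close>.\<close>
  then show "C = cnj B" "A \<in> \<real>"
    by (simp_all add: p_def complex_is_Real_iff complex_eq_iff mult.commute)
qed

lemma real_conic_locus:
  assumes "A \<in> \<real>" "C = cnj B"
  shows "cp3_sigma ` plane_locus t (conic_poly A B C) = plane_locus t (conic_poly A B C)"
proof -
  have A: "cnj A = A" using assms(1) by (simp add: Reals_cnj_iff)
  have sub: "cp3_sigma P \<in> plane_locus t (conic_poly A B C)" "cp3_sigma (cp3_sigma P) = P"
    if P: "P \<in> plane_locus t (conic_poly A B C)" for P
  proof -
    obtain y1 y2 y3 where y: "P = plane_pt t (y1, y2, y3)" "(y1, y2, y3) \<noteq> (0, 0, 0)"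
      "eval3 (conic_poly A B C) (y1, y2, y3) = 0"
      using P by (auto simp: plane_locus_def)
    have "eval3 (conic_poly A B C) (cnj y1, cnj y3, cnj y2) = cnj (eval3 (conic_poly A B C) (y1, y2, y3))"
      by (simp add: A assms(2) mult_ac add_ac)
    moreover have "(cnj y1, cnj y3, cnj y2) \<noteq> (0, 0, 0)" using y(2) by auto
    ultimately show "cp3_sigma P \<in> plane_locus t (conic_poly A B C)" "cp3_sigma (cp3_sigma P) = P"
      using y by (simp_all add: cp3_sigma_plane_pt plane_pt_in_plane_locus[OF homogeneous_conic] del: eval3_conic)
  qed
  show ?thesis
  proof
    show "cp3_sigma ` plane_locus t (conic_poly A B C) \<subseteq> plane_locus t (conic_poly A B C)"
      using sub(1) by blast
    show "plane_locus t (conic_poly A B C) \<subseteq> cp3_sigma ` plane_locus t (conic_poly A B C)"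
      using sub by (metis image_eqI subsetI)
  qed
qed

section \<open>Irreducibility of the conic and rescaling of its equation\<close>

lemma not_unit_eval3: "eval3 F (0, 0, 0) = 0 \<Longrightarrow> \<not> F dvd 1"
  by (metis dvdE eval3_hom(2,6) mult_zero_left zero_neq_one)

text \<open>For \<open>A = B * C\<close> the conic is a pair of lines, one through each point at
  infinity.\<close>

lemma irreducible_conic_neq:
  assumes "irreducible (conic_poly A B C)"
  shows "A \<noteq> B * C"
proof
  assume "A = B * C"
  then have "conic_poly A B C = (Y2 + cst C * Y1) * (Y3 + cst B * Y1)"
    by (simp add: conic_poly_def algebra_simps power2_eq_square)
  then show False
    using irreducibleD[OF assms] not_unit_eval3[of "Y2 + cst C * Y1"] not_unit_eval3[of "Y3 + cst B * Y1"] by auto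
qed

text \<open>The equation is linear in \<open>Y3\<close>, so one of two factors is free of
  \<open>Y3\<close> and divides both \<open>a0\<close> and \<open>a1\<close>. It then divides
  \<open>(A - B * C) * Y1^2\<close>, so it is free of \<open>Y2\<close> as well, and it divides the
  coefficient 1 of \<open>Y2\<close> in \<open>a1\<close>.\<close>

lemma irreducible_conicI:
  assumes "A \<noteq> B * C"
  shows "irreducible (conic_poly A B C)"
proof -
  define a0 a1 :: "complex poly poly" where "a0 = [:[:0, 0, A:], [:0, B:]:]" and "a1 = [:[:0, C:], 1:]"
  have F: "conic_poly A B C = [:a0, a1:]"
    by (simp add: conic_poly_def cst_def Y1_def Y2_def Y3_def a0_def a1_def power2_eq_square one_pCons)
  have unit: "g dvd 1" if g: "g dvd conic_poly A B C" "degree g = 0" for g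
  proof -
    obtain p where p: "g = [:p:]" using g(2) degree_eq_zeroE by blast
    have "p dvd a0" "p dvd a1"
      using g(1) unfolding p F by (auto simp: const_poly_dvd_iff coeff_pCons split: nat.splits)
    then have "p dvd a0 - [:[:0, B:]:] * a1" by (intro dvd_diff dvd_mult)
    also have "\<dots> = [:[:0, 0, A - B * C:]:]"
      by (simp add: a0_def a1_def)
    finally have "degree p \<le> degree [:[:0, 0, A - B * C:]:]"
      using assms by (intro dvd_imp_degree_le) auto
    then have "degree p = 0" by simp
    then obtain c where c: "p = [:c:]" using degree_eq_zeroE by blast
    then have "c dvd coeff a1 1"
      using \<open>p dvd a1\<close> by (simp only: const_poly_dvd_iff)
    then show ?thesis by (simp add: a1_def p c is_unit_const_poly_iff)
  qed
  show ?thesis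
  proof (rule irreducibleI)
    show "conic_poly A B C \<noteq> 0" by (simp add: F a1_def)
    show "\<not> conic_poly A B C dvd 1" by (rule not_unit_eval3) simp
    fix g h assume gh: "conic_poly A B C = g * h"
    have nz: "conic_poly A B C \<noteq> 0" "degree (conic_poly A B C) = 1"
      by (simp_all add: F a1_def)
    then have "g \<noteq> 0" "h \<noteq> 0"
      unfolding gh by auto
    then have "degree g + degree h = 1"
      using nz(2) unfolding gh by (simp add: degree_mult_eq)
    then have "degree g = 0 \<or> degree h = 0" by arith
    moreover have "g dvd conic_poly A B C" "h dvd conic_poly A B C"
      by (simp_all add: gh)
    ultimately show "g dvd 1 \<or> h dvd 1" using unit by blast
  qed
qed

lemma plane_locus_cst_mult: "c \<noteq> 0 \<Longrightarrow> plane_locus t (cst c * F) = plane_locus t F"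
  by (simp add: plane_locus_def)

lemma int_mult_cst_mult:
  assumes "c \<noteq> 0"
  shows "int_mult P (cst c * F) G = int_mult P F G"
proof -
  have 1: "local_ideal P (cst d * F) G \<subseteq> local_ideal P F G" for d F
  proof
    fix x assume "x \<in> local_ideal P (cst d * F) G"
    then obtain U V D k where UV: "x = Fract (U * (cst d * F) + V * G) D" "homogeneous k (U * (cst d * F))"
      "homogeneous k (V * G)" "homogeneous k D" "eval3 D P \<noteq> 0" "D \<noteq> 0"
      by (elim local_idealE)
    then show "x \<in> local_ideal P F G"
      unfolding UV(1) by (intro local_idealI[of k "U * cst d" F V G D]) (simp_all add: mult.assoc)
  qed
  have inv: "cst (1 / c) * (cst c * F) = F"
    using assms by (simp flip: mult.assoc cst_hom(2))
  then have "local_ideal P (cst c * F) G = local_ideal P F G"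
    using 1[of c F] 1[of "1 / c" "cst c * F"] unfolding inv by blast
  then show ?thesis by (simp add: int_mult_def)
qed

lemma irreducible_cst_mult:
  assumes "c \<noteq> 0" "irreducible (cst c * F)"
  shows "irreducible F"
proof -
  have "cst c dvd 1"
    by (rule dvdI[of _ _ "cst (1 / c)"]) (use assms(1) in \<open>simp flip: cst_hom(2)\<close>)
  then show ?thesis using assms(2) by (simp add: irreducible_mult_unit_left)
qed

section \<open>Normal form of special conics and the discriminant condition for touching\<close>

text \<open>A nonzero intersection number forces the conic through the point, which removes the
  squares of \<open>Y2\<close> and \<open>Y3\<close>. Without the term \<open>Y2 * Y3\<close> the
  line \<open>Y1 = 0\<close> would split off, so division by its coefficient is possible.\<close>

lemma special_conic_normal_form:
  assumes F: "irreducible_conic F" and "int_mult (0, 0, 1) F G \<noteq> 0" "int_mult (0, 1, 0) F G \<noteq> 0"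
  obtains c A B C where "c \<noteq> 0" "F = cst c * conic_poly A B C"
proof -
  obtain A B C D E H where ABC:
    "F = cst A * Y1^2 + cst B * Y1 * Y2 + cst C * Y1 * Y3 + cst D * Y2^2 + cst E * Y2 * Y3 + cst H * Y3^2"
    using F homogeneous_2_expand unfolding irreducible_conic_def by blast
  have "eval3 F (0, 0, 1) = 0" "eval3 F (0, 1, 0) = 0"
    using assms int_mult_eq_0 unfolding irreducible_conic_def by blast+
  then have 0: "D = 0" "H = 0" by (simp_all add: ABC)
  have "E \<noteq> 0"
  proof
    assume "E = 0"
    then have "F = Y1 * (cst A * Y1 + cst B * Y2 + cst C * Y3)"
      by (simp add: ABC 0 algebra_simps power2_eq_square)
    then have "Y1 dvd 1 \<or> (cst A * Y1 + cst B * Y2 + cst C * Y3) dvd 1"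
      using F irreducibleD unfolding irreducible_conic_def by blast
    then show False
      using not_unit_eval3[of Y1] not_unit_eval3[of "cst A * Y1 + cst B * Y2 + cst C * Y3"] by auto
  qed
  have "cst E * conic_poly (A / E) (B / E) (C / E) = cst (E * (A / E)) * Y1^2 + cst (E * (B / E)) * Y1 * Y2
      + cst (E * (C / E)) * Y1 * Y3 + cst E * Y2 * Y3"
    by (simp only: conic_poly_def cst_hom(2) distrib_left mult.assoc)
  also have "\<dots> = F"
    using \<open>E \<noteq> 0\<close> by (simp add: ABC 0 del: cst_hom(2))
  finally have "F = cst E * conic_poly (A / E) (B / E) (C / E)" by simp
  then show ?thesis using that \<open>E \<noteq> 0\<close> by blast
qed

text \<open>A nonzero discriminant gives a simple root \<open>u\<close>, and
  \<open>(1, u, v)\<close> with \<open>v\<close> solved from the conic is a transversal intersection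
  with the \<alpha>-component, of multiplicity at most 1.\<close>

lemma touching_discriminant:
  assumes B: "B \<noteq> 0" and "C \<noteq> 0" "A \<noteq> B * C" "\<alpha> \<noteq> \<beta>"
    and touch: "\<And>y. y \<noteq> (0, 0, 0) \<Longrightarrow> eval3 (conic_poly A B C) y = 0 \<Longrightarrow> eval3 (conic_pair \<alpha> \<beta>) y = 0 \<Longrightarrow>
      2 \<le> int_mult y (conic_poly A B C) (conic_pair \<alpha> \<beta>)"
  shows "(A - \<alpha>)^2 + 4 * \<alpha> * B * C = 0"
proof (rule ccontr)
  define \<delta> where "\<delta> = csqrt ((A - \<alpha>)^2 + 4 * \<alpha> * B * C)"
  assume "(A - \<alpha>)^2 + 4 * \<alpha> * B * C \<noteq> 0"
  then have "\<delta> \<noteq> 0" by (simp add: \<delta>_def)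
  have \<delta>2: "\<delta> * \<delta> = (A - \<alpha>)^2 + 4 * \<alpha> * B * C"
    by (simp add: \<delta>_def flip: power2_eq_square)
  define u u' where "u = (\<alpha> - A + \<delta>) / (2 * B)" and "u' = (\<alpha> - A - \<delta>) / (2 * B)"
  have "u \<noteq> u'"
    using B \<open>\<delta> \<noteq> 0\<close> by (auto simp: u_def u'_def)
  have sum: "B * (u + u') = \<alpha> - A"
    using B by (simp add: u_def u'_def field_simps)
  have "4 * B * (B * u * u') = (\<alpha> - A)^2 - \<delta> * \<delta>"
    using B by (simp add: u_def u'_def field_simps power2_eq_square)
  also have "\<dots> = 4 * B * (- \<alpha> * C)"
    unfolding \<delta>2 by (simp add: algebra_simps power2_eq_square)
  finally have prod: "B * u * u' = - \<alpha> * C"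
    using B by (subst (asm) mult_left_cancel) auto
  have u: "B * u^2 + (A - \<alpha>) * u - \<alpha> * C = 0"
  proof -
    have "B * u^2 + (A - \<alpha>) * u - \<alpha> * C = B * u^2 - B * (u + u') * u + B * u * u'"
      unfolding sum prod by (simp add: algebra_simps)
    also have "\<dots> = 0" by (simp add: algebra_simps power2_eq_square)
    finally show ?thesis .
  qed
  \<comment> \<open>At \<open>u = - C\<close> the conic could not be solved for \<open>v\<close>;
    there the quadratic takes the value \<open>C * (B * C - A)\<close>, which is nonzero.\<close>
  have uC: "u + C \<noteq> 0"
  proof
    assume "u + C = 0"
    then have "u = - C" by (simp add: eq_neg_iff_add_eq_0)
    then have "C * (B * C - A) = 0"
      using u by (simp add: algebra_simps power2_eq_square)
    then show False using \<open>A \<noteq> B * C\<close> \<open>C \<noteq> 0\<close> by simp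
  qed
  \<comment> \<open>The quadratics of the two components differ by
    \<open>(\<alpha> - \<beta>) * (u + C)\<close>, so the point avoids the
    \<beta>-component.\<close>
  have "(B * u^2 + (A - \<beta>) * u - \<beta> * C) = (B * u^2 + (A - \<alpha>) * u - \<alpha> * C) + (\<alpha> - \<beta>) * (u + C)"
    by (simp add: algebra_simps)
  then have h\<beta>: "B * u^2 + (A - \<beta>) * u - \<beta> * C \<noteq> 0"
    using uC \<open>\<alpha> \<noteq> \<beta>\<close> u by simp
  define v where "v = - (A + B * u) / (u + C)"
  have v: "v * (u + C) = - (A + B * u)" using uC by (simp add: v_def)
  then have P: "A + B * u + C * v + u * v = 0" by (simp add: algebra_simps)
  have "(u + C) * (u * v + \<alpha>) = u * (v * (u + C)) + \<alpha> * (u + C)"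
    by (simp add: algebra_simps)
  also have "\<dots> = - (B * u^2 + (A - \<alpha>) * u - \<alpha> * C)"
    unfolding v by (simp add: algebra_simps power2_eq_square)
  finally have "u * v + \<alpha> = 0" using u uC by simp
  then have "2 \<le> int_mult (1, u, v) (conic_poly A B C) (conic_pair \<alpha> \<beta>)"
    using P by (intro touch) simp_all
  moreover have "int_mult (1, u, v) (conic_poly A B C) (conic_pair \<alpha> \<beta>) \<le> 1"
    by (rule int_mult_transversal_le[OF B uC \<open>u \<noteq> u'\<close> sum prod h\<beta> P])
  ultimately have "(2 :: enat) \<le> 1" by (rule order_trans)
  then show False by simp
qed

text \<open>Excludes the alternative that the conic lies in the quartic: outside the finitely many
  roots of \<open>p\<close>, a point \<open>(1, z, w)\<close> of the conic exists by the third
  factor and avoids both components by the first two.\<close>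

lemma conic_not_in_pair:
  assumes "B \<noteq> 0"
  obtains y where "y \<noteq> (0, 0, 0)" "eval3 (conic_poly A B C) y = 0" "eval3 (conic_pair \<alpha> \<beta>) y \<noteq> 0"
proof -
  define p where "p = [:- \<alpha> * C, A - \<alpha>, B:] * [:- \<beta> * C, A - \<beta>, B:] * [:C, 1:]"
  have "p \<noteq> 0" using assms by (simp add: p_def del: mult_pCons_left mult_pCons_right)
  then have "{z. poly p z = 0} \<noteq> UNIV"
    using poly_roots_finite[of p] infinite_UNIV_char_0 by metis
  then obtain z where z: "poly p z \<noteq> 0" by blast
  then have zC: "z + C \<noteq> 0" by (auto simp: p_def add.commute simp del: mult_pCons_left mult_pCons_right)
  define w where "w = - (A + B * z) / (z + C)"
  have w: "w * (z + C) = - (A + B * z)" using zC by (simp add: w_def)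
  have 1: "(z + C) * (z * w + c) = - poly [:- c * C, A - c, B:] z" for c
  proof -
    have "(z + C) * (z * w + c) = z * (w * (z + C)) + c * (z + C)"
      by (simp add: algebra_simps)
    also have "\<dots> = - poly [:- c * C, A - c, B:] z"
      unfolding w by (simp add: algebra_simps)
    finally show ?thesis .
  qed
  show ?thesis
  proof
    show "(1, z, w) \<noteq> (0 :: complex, 0 :: complex, 0 :: complex)" by simp
    show "eval3 (conic_poly A B C) (1, z, w) = 0" using w by (simp add: algebra_simps)
    have "poly [:- \<alpha> * C, A - \<alpha>, B:] z \<noteq> 0" "poly [:- \<beta> * C, A - \<beta>, B:] z \<noteq> 0"
      using z by (simp_all only: p_def poly_mult) simp_all
    then have "z * w + \<alpha> \<noteq> 0" "z * w + \<beta> \<noteq> 0" using 1 by (metis mult_zero_right neg_equal_0_iff_equal)+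
    then show "eval3 (conic_pair \<alpha> \<beta>) (1, z, w) \<noteq> 0" by simp
  qed
qed

lemma double_root:
  fixes A B C \<alpha> :: complex
  assumes "B \<noteq> 0" "(A - \<alpha>)^2 + 4 * \<alpha> * B * C = 0"
  shows "B * s^2 + (A - \<alpha>) * s - \<alpha> * C = B * (s - (\<alpha> - A) / (2 * B))^2"
proof -
  have "4 * B * (B * s^2 + (A - \<alpha>) * s - \<alpha> * C) = (2 * B * s + (A - \<alpha>))^2 - ((A - \<alpha>)^2 + 4 * \<alpha> * B * C)"
    by (simp add: algebra_simps power2_eq_square)
  also have "\<dots> = (2 * B * (s - (\<alpha> - A) / (2 * B)))^2"
  proof -
    have "2 * B * (s - (\<alpha> - A) / (2 * B)) = 2 * B * s + (A - \<alpha>)"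
      using assms(1) by (simp add: field_simps)
    then show ?thesis using assms(2) by simp
  qed
  also have "\<dots> = 4 * B * (B * (s - (\<alpha> - A) / (2 * B))^2)"
    by (simp add: power_mult_distrib) (simp add: power2_eq_square)
  finally show ?thesis using assms(1) by (subst (asm) mult_left_cancel) auto
qed

lemma conic_pair_commute: "conic_pair \<alpha> \<beta> = conic_pair \<beta> \<alpha>"
  by (simp add: conic_pair_def mult.commute)

text \<open>Points at infinity are covered by the arcs there. Any other point lies on one component,
  and eliminating \<open>y3\<close> shows that its \<open>y2 / y1\<close> is the double root
  belonging to that component.\<close>

lemma int_mult_tangent_ge:
  assumes B: "B \<noteq> 0" and "A \<noteq> B * C"
    and "(A - \<alpha>)^2 + 4 * \<alpha> * B * C = 0" "(A - \<beta>)^2 + 4 * \<beta> * B * C = 0"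
    and y: "y \<noteq> (0, 0, 0)" "eval3 (conic_poly A B C) y = 0" "eval3 (conic_pair \<alpha> \<beta>) y = 0"
  shows "2 \<le> int_mult y (conic_poly A B C) (conic_pair \<alpha> \<beta>)"
proof -
  obtain y1 y2 y3 where yy: "y = (y1, y2, y3)" by (cases y)
  show ?thesis
  proof (cases "y1 = 0")
    case True
    then have "y2 = 0 \<and> y3 \<noteq> 0 \<or> y3 = 0 \<and> y2 \<noteq> 0" using y by (auto simp: yy)
    then show ?thesis
      using int_mult_infinity1_ge[of y3] int_mult_infinity2_ge[of y2] True yy by auto
  next
    case False
    have *: "2 \<le> int_mult y (conic_poly A B C) (conic_pair \<gamma> \<delta>)"
      if \<gamma>: "(A - \<gamma>)^2 + 4 * \<gamma> * B * C = 0" and 0: "y2 * y3 + \<gamma> * y1^2 = 0" for \<gamma> \<delta>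
    proof -
      define s where "s = y2 / y1"
      have s: "y2 = s * y1" using False by (simp add: s_def)
      have "y1^3 * (B * s^2 + (A - \<gamma>) * s - \<gamma> * C) =
          y2 * eval3 (conic_poly A B C) y - (C * y1 + y2) * (y2 * y3 + \<gamma> * y1^2)"
        by (simp add: yy s algebra_simps power2_eq_square power3_eq_cube)
      also have "\<dots> = 0" using y 0 by simp
      finally have "B * (s - (\<gamma> - A) / (2 * B))^2 = 0"
        unfolding double_root[OF B \<gamma>] using False by simp
      then have "y2 = (\<gamma> - A) / (2 * B) * y1" using B s by simp
      then show ?thesis
        unfolding yy using double_root[OF B \<gamma>] y(2) yy \<open>A \<noteq> B * C\<close> False
        by (intro int_mult_touching_ge) auto
    qed
    have "y2 * y3 + \<alpha> * y1^2 = 0 \<or> y2 * y3 + \<beta> * y1^2 = 0" using y(3) by (simp add: yy)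
    then show ?thesis
      using *[OF assms(3)] *[OF assms(4)] conic_pair_commute by metis
  qed
qed

text \<open>The discriminant is recorded for \<alpha> alone: for \<open>f > 0\<close> it already
  fails when \<alpha> is positive, and for \<open>f < 0\<close> the one for \<beta> is its complex
  conjugate.\<close>

lemma real_touching_special_normal_form:
  fixes \<alpha> \<beta> :: complex
  assumes pair: "\<alpha> + \<beta> = 2 * of_real (qform Q t 1)" "\<alpha> * \<beta> = of_real ((qform Q t 1)^2 - cubic a b t)"
    and "\<alpha> \<noteq> \<beta>" and F: "real_touching_conic a b Q t F" "special_type a b Q t F"
  obtains c A B where "c \<noteq> 0" "F = cst c * conic_poly (of_real A) B (cnj B)" "B \<noteq> 0"
    "(of_real A - \<alpha>)^2 + 4 * \<alpha> * of_real ((cmod B)^2) = 0"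
proof -
  note curve = quartic_curve_eq_conic_pair[OF pair]
  have special: "int_mult (0, 0, 1) F (conic_pair \<alpha> \<beta>) = 2" "int_mult (0, 1, 0) F (conic_pair \<alpha> \<beta>) = 2"
    using F(2) by (simp_all add: special_type_def curve)
  have irr: "irreducible_conic F" and sigma: "cp3_sigma ` plane_locus t F = plane_locus t F"
    and touch: "plane_locus t F \<subseteq> quartic_surface a b Q \<or>
      (\<forall>y. y \<noteq> (0, 0, 0) \<and> plane_pt t y \<in> plane_locus t F \<inter> quartic_surface a b Q \<longrightarrow>
         2 \<le> int_mult y F (conic_pair \<alpha> \<beta>))"
    using F(1) unfolding real_touching_conic_def curve by blast+
  have "int_mult (0, 0, 1) F (conic_pair \<alpha> \<beta>) \<noteq> 0" "int_mult (0, 1, 0) F (conic_pair \<alpha> \<beta>) \<noteq> 0"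
    by (simp_all add: special)
  then obtain c A B C where c: "c \<noteq> 0" and Fc: "F = cst c * conic_poly A B C"
    by (rule special_conic_normal_form[OF irr])
  have "irreducible (conic_poly A B C)"
    using irr irreducible_cst_mult[OF c] unfolding irreducible_conic_def Fc by blast
  then have ABC: "A \<noteq> B * C" by (rule irreducible_conic_neq)
  have CB: "C = cnj B" "A \<in> \<real>"
    using sigma unfolding Fc plane_locus_cst_mult[OF c] by (rule real_conic_coeffs)+
  have "C \<noteq> 0"
  proof
    assume "C = 0"
    then have "(3 :: enat) \<le> 2"
      using special(1) int_mult_infinity1_tangent_ge[of A B \<alpha> \<beta>] unfolding Fc int_mult_cst_mult[OF c] by simp
    then show False by simp
  qed
  then have "B \<noteq> 0" using CB by simp
  have "\<not> plane_locus t F \<subseteq> quartic_surface a b Q"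
  proof -
    obtain y where y: "y \<noteq> (0, 0, 0)" "eval3 (conic_poly A B C) y = 0" "eval3 (conic_pair \<alpha> \<beta>) y \<noteq> 0"
      using conic_not_in_pair[OF \<open>B \<noteq> 0\<close>] by blast
    then show ?thesis
      using plane_pt_in_quartic_surface[OF pair y(1)] plane_pt_in_plane_locus[OF homogeneous_conic y(1)]
      unfolding Fc plane_locus_cst_mult[OF c] by blast
  qed
  then have "2 \<le> int_mult y (conic_poly A B C) (conic_pair \<alpha> \<beta>)"
    if "y \<noteq> (0, 0, 0)" "eval3 (conic_poly A B C) y = 0" "eval3 (conic_pair \<alpha> \<beta>) y = 0" for y
    using touch that plane_pt_in_quartic_surface[OF pair that(1)] plane_pt_in_plane_locus[OF homogeneous_conic that(1)]
    unfolding Fc plane_locus_cst_mult[OF c] int_mult_cst_mult[OF c] by blast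
  then have "(A - \<alpha>)^2 + 4 * \<alpha> * B * C = 0"
    by (rule touching_discriminant[OF \<open>B \<noteq> 0\<close> \<open>C \<noteq> 0\<close> ABC \<open>\<alpha> \<noteq> \<beta>\<close>])
  moreover have "B * C = of_real ((cmod B)^2)"
    by (simp only: CB(1) complex_norm_square)
  ultimately have "(A - \<alpha>)^2 + 4 * \<alpha> * of_real ((cmod B)^2) = 0"
    by (simp only: mult.assoc)
  then show ?thesis
    using that[OF c, of "Re A" B] \<open>B \<noteq> 0\<close> Fc CB by (simp add: of_real_Re)
qed

section \<open>Parameters where the cubic is positive\<close>

text \<open>The discriminant becomes a real square plus \<open>4 * \<alpha> * (cmod B)^2\<close>
  with \<alpha> positive and \<open>B\<close> nonzero, so it cannot vanish.\<close>

lemma no_touching_conic_positive: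
  assumes f: "cubic a b t > 0" and pos: "qform Q t 1 + sqrt (cubic a b t) > 0"
    and F: "real_touching_conic a b Q t F" "special_type a b Q t F"
  shows False
proof -
  define s where "s = sqrt (cubic a b t)"
  have s: "s > 0" "s * s = cubic a b t" using f by (simp_all add: s_def)
  define \<alpha> \<beta> :: complex where "\<alpha> = of_real (qform Q t 1 + s)" and "\<beta> = of_real (qform Q t 1 - s)"
  have "(qform Q t 1 + s) * (qform Q t 1 - s) = (qform Q t 1)^2 - cubic a b t"
    by (simp add: algebra_simps power2_eq_square flip: s(2))
  then have pair: "\<alpha> + \<beta> = 2 * of_real (qform Q t 1)" "\<alpha> * \<beta> = of_real ((qform Q t 1)^2 - cubic a b t)" "\<alpha> \<noteq> \<beta>"
    using s(1) by (simp_all only: \<alpha>_def \<beta>_def of_real_mult[symmetric]) simp_all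
  obtain c A B where B: "B \<noteq> 0" "(of_real A - \<alpha>)^2 + 4 * \<alpha> * of_real ((cmod B)^2) = 0"
    using real_touching_special_normal_form[OF pair F] by blast
  have "complex_of_real ((A - (qform Q t 1 + s))^2 + 4 * (qform Q t 1 + s) * (cmod B)^2) = 0"
    using B(2) by (simp add: \<alpha>_def)
  then have "(A - (qform Q t 1 + s))^2 + 4 * (qform Q t 1 + s) * (cmod B)^2 = 0"
    by (simp only: of_real_eq_0_iff)
  moreover have "4 * (qform Q t 1 + s) * (cmod B)^2 > 0"
    using pos B(1) by (simp add: s_def)
  ultimately show False
    using zero_le_power2[of "A - (qform Q t 1 + s)"] by linarith
qed

section \<open>The circle of conics over a parameter where the cubic is negative\<close>

context
  fixes q f S r :: real
  assumes f: "f < 0"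
  defines "S \<equiv> sqrt (q^2 - f)" and "r \<equiv> sqrt ((S - q) / 2)"
begin

text \<open>The inequalities rest on \<open>S\<close> exceeding the absolute value of
  \<open>q\<close>, which holds because \<open>f < 0\<close>; the last one excludes reducible
  members and real points.\<close>

lemma radius_facts: "S^2 = q^2 - f" "\<bar>q\<bar> < S" "0 < S" "0 < r" "r^2 = (S - q) / 2" "r^2 < S"
proof -
  have "q^2 < q^2 - f" using f by simp
  then have "sqrt (q^2) < S" unfolding S_def by (rule real_sqrt_less_mono)
  then show "\<bar>q\<bar> < S" by simp
  then show "0 < S" "0 < r" by (auto simp: r_def)
  show "S^2 = q^2 - f"
    using f zero_le_power2[of q] unfolding S_def by (intro real_sqrt_pow2) linarith
  show "r^2 = (S - q) / 2"
    using \<open>\<bar>q\<bar> < S\<close> unfolding r_def by (intro real_sqrt_pow2) auto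
  then show "r^2 < S" using \<open>\<bar>q\<bar> < S\<close> by auto
qed

lemma conic_family_conic:
  "conic_family q f \<theta> = conic_poly (of_real S) (of_real r * exp (\<i> * of_real \<theta>)) (cnj (of_real r * exp (\<i> * of_real \<theta>)))"
proof -
  have "exp (- \<i> * of_real \<theta>) = cnj (exp (\<i> * of_real \<theta>))" by (simp add: exp_cnj)
  then show ?thesis by (simp add: conic_family_def conic_poly_def S_def r_def)
qed

lemma family_product: "of_real r * exp (\<i> * of_real \<theta>) * cnj (of_real r * exp (\<i> * of_real \<theta>)) = of_real (r^2)"
  by (simp only: complex_norm_square[symmetric]) (simp add: norm_mult)

text \<open>With \<open>4 * r^2 = 2 * S - (\<alpha> + \<beta>)\<close> the expression collapses to
  \<open>S^2 - \<alpha> * \<beta>\<close>. The hypotheses are symmetric, so exchanging the two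
  parameters gives the other discriminant.\<close>

lemma family_discriminant:
  assumes "\<alpha> + \<beta> = 2 * of_real q" "\<alpha> * \<beta> = of_real (q^2 - f)"
  shows "(of_real S - \<alpha>)^2 + 4 * \<alpha> * of_real (r^2) = (0 :: complex)"
proof -
  have "complex_of_real (4 * r^2) = of_real (2 * S - 2 * q)"
    using radius_facts(5) by (simp only:) simp
  then have r: "4 * of_real (r^2) = 2 * of_real S - (\<alpha> + \<beta>)"
    unfolding assms by simp
  have "(of_real S - \<alpha>)^2 + \<alpha> * (4 * of_real (r^2)) = of_real (S^2) - \<alpha> * \<beta>"
    unfolding r by (simp add: algebra_simps power2_eq_square)
  also have "\<dots> = 0"
    unfolding assms radius_facts(1) by simp
  finally have "(of_real S - \<alpha>)^2 + \<alpha> * (4 * of_real (r^2)) = 0" .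
  then show ?thesis by (simp add: mult_ac)
qed

text \<open>The imaginary part gives \<open>A = q + 2 * n\<close>; inserted into the real part this
  gives \<open>A^2 = q^2 - f\<close>. The sign of \<open>A\<close> is decided by
  \<open>n > 0\<close> together with \<open>q > - S\<close>.\<close>

lemma conic_coeffs_unique:
  assumes B: "B \<noteq> 0"
    and eq: "(of_real A - Complex q (sqrt (- f)))^2 + 4 * Complex q (sqrt (- f)) * of_real ((cmod B)^2) = 0"
  shows "A = S" "cmod B = r"
proof -
  define R n where "R = sqrt (- f)" and "n = (cmod B)^2"
  have R: "R > 0" "R^2 = - f" using f by (simp_all add: R_def)
  have n: "n > 0" using B by (simp add: n_def)
  have "Re ((of_real A - Complex q R)^2 + 4 * Complex q R * of_real n) = 0"
    "Im ((of_real A - Complex q R)^2 + 4 * Complex q R * of_real n) = 0"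
    using eq unfolding R_def n_def by simp_all
  then have re: "(A - q)^2 - R^2 + 4 * q * n = 0" and im: "2 * R * (2 * n - (A - q)) = 0"
    by (simp_all add: power2_eq_square algebra_simps)
  have A: "A = q + 2 * n" using im R by simp
  have "A^2 = S^2"
    using re unfolding radius_facts(1) R(2) by (simp add: A power2_eq_square algebra_simps)
  then have "A = S \<or> A = - S" by (simp add: power2_eq_iff)
  then show "A = S" using A n radius_facts(2) by auto
  then have "n = r^2" using A radius_facts(5) by simp
  then show "cmod B = r" using radius_facts(4) by (simp add: n_def power2_eq_iff_nonneg)
qed

text \<open>This is the parametrisation by a circle. Besides a point at infinity the conic meets the
  line \<open>y3 = 0\<close> only at \<open>(1, - S / B, 0)\<close>, which determines
  \<open>B\<close>.\<close>

lemma family_locus_eq_iff: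
  "plane_locus t (conic_family q f \<theta>) = plane_locus t (conic_family q f \<theta>') \<longleftrightarrow>
   exp (\<i> * of_real \<theta>) = exp (\<i> * of_real \<theta>')"
proof
  assume eq: "plane_locus t (conic_family q f \<theta>) = plane_locus t (conic_family q f \<theta>')"
  define B B' where "B = of_real r * exp (\<i> * of_real \<theta>)" and "B' = of_real r * exp (\<i> * of_real \<theta>')"
  have "B \<noteq> 0" "S \<noteq> 0" using radius_facts by (auto simp: B_def)
  let ?y = "(1, - of_real S / B, 0) :: complex \<times> complex \<times> complex"
  have "plane_pt t ?y \<in> plane_locus t (conic_family q f \<theta>)"
    unfolding conic_family_conic B_def[symmetric] using \<open>B \<noteq> 0\<close>
    by (subst plane_pt_in_plane_locus[OF homogeneous_conic]) auto
  then have "plane_pt t ?y \<in> plane_locus t (conic_family q f \<theta>')"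
    using eq by simp
  then have "of_real S + B' * (- of_real S / B) = 0"
    unfolding conic_family_conic B'_def[symmetric]
    by (subst (asm) plane_pt_in_plane_locus[OF homogeneous_conic]) auto
  then have "B = B'" using \<open>B \<noteq> 0\<close> \<open>S \<noteq> 0\<close> by (simp add: field_simps)
  then show "exp (\<i> * of_real \<theta>) = exp (\<i> * of_real \<theta>')"
    using radius_facts(4) by (simp add: B_def B'_def)
next
  assume "exp (\<i> * of_real \<theta>) = exp (\<i> * of_real \<theta>')"
  then show "plane_locus t (conic_family q f \<theta>) = plane_locus t (conic_family q f \<theta>')"
    unfolding conic_family_conic by simp
qed

text \<open>At a fixed point of the real structure the equation becomes, up to the factor
  \<open>c\<close>, the Hermitian form
  \<open>(S - r^2) * (cmod y1)^2 + (cmod (y2 + cnj B * y1))^2\<close>, which is positive definite as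
  \<open>r^2 < S\<close>.\<close>

lemma family_no_real_point:
  assumes P: "P \<in> plane_locus t (conic_family q f \<theta>)"
  shows "cp3_sigma P \<noteq> P"
proof
  assume real: "cp3_sigma P = P"
  define B where "B = of_real r * exp (\<i> * of_real \<theta>)"
  obtain y1 y2 y3 where y: "P = plane_pt t (y1, y2, y3)" "(y1, y2, y3) \<noteq> (0, 0, 0)"
    "eval3 (conic_poly (of_real S) B (cnj B)) (y1, y2, y3) = 0"
    using P unfolding conic_family_conic B_def[symmetric] by (auto simp: plane_locus_def)
  have "pt (of_real t * cnj y1) (cnj y1) (cnj y3) (cnj y2) = pt (of_real t * y1) y1 y2 y3"
    using real y(1,2) by (simp add: cp3_sigma_plane_pt) (simp add: plane_pt_def)
  moreover have nz: "(of_real t * cnj y1, cnj y1, cnj y3, cnj y2) \<noteq> (0, 0, 0, 0)"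
    "(of_real t * y1, y1, y2, y3) \<noteq> (0, 0, 0, 0)"
    using y(2) by auto
  ultimately obtain c where c: "c \<noteq> 0" "y1 = c * cnj y1" "y2 = c * cnj y3" "y3 = c * cnj y2"
    unfolding pt_eq_iff[OF nz] by blast
  have BB: "B * cnj B = of_real (r^2)"
    unfolding B_def by (rule family_product)
  have "c * (of_real ((S - r^2) * (cmod y1)^2 + (cmod (y2 + cnj B * y1))^2)) =
      c * ((of_real S - B * cnj B) * (y1 * cnj y1) + (y2 + cnj B * y1) * cnj (y2 + cnj B * y1))"
    unfolding BB by (simp only: of_real_add of_real_mult of_real_diff complex_norm_square)
  also have "\<dots> = of_real S * y1 * (c * cnj y1) + B * (c * cnj y1) * y2 + cnj B * y1 * (c * cnj y2) + y2 * (c * cnj y2)"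
    by (simp add: algebra_simps)
  also have "\<dots> = eval3 (conic_poly (of_real S) B (cnj B)) (y1, y2, y3)"
    unfolding c(2,4)[symmetric] by (simp add: power2_eq_square)
  also have "\<dots> = 0" by (rule y(3))
  finally have 0: "(S - r^2) * (cmod y1)^2 + (cmod (y2 + cnj B * y1))^2 = 0"
    using c(1) by (metis mult_eq_0_iff of_real_eq_0_iff)
  have "(S - r^2) * (cmod y1)^2 \<ge> 0" using radius_facts(6) by simp
  then have "(S - r^2) * (cmod y1)^2 = 0" "(cmod (y2 + cnj B * y1))^2 = 0"
    using 0 zero_le_power2[of "cmod (y2 + cnj B * y1)"] by linarith+
  then have "y1 = 0" "y2 = 0" using radius_facts(6) by auto
  then show False using c(4) y(2) by simp
qed

lemma family_touching_special:
  assumes Q: "q = qform Q t 1" "f = cubic a b t"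
  shows "real_touching_conic a b Q t (conic_family q f \<theta>) \<and> special_type a b Q t (conic_family q f \<theta>)"
proof -
  define \<alpha> \<beta> where "\<alpha> = Complex q (sqrt (- f))" and "\<beta> = Complex q (- sqrt (- f))"
  have pair: "\<alpha> + \<beta> = 2 * of_real (qform Q t 1)" "\<alpha> * \<beta> = of_real ((qform Q t 1)^2 - cubic a b t)"
    using f by (simp_all add: \<alpha>_def \<beta>_def complex_eq_iff power2_eq_square flip: Q)
  then have pair': "\<beta> + \<alpha> = 2 * of_real (qform Q t 1)" "\<beta> * \<alpha> = of_real ((qform Q t 1)^2 - cubic a b t)"
    by (simp_all only: add.commute mult.commute)
  define B where "B = of_real r * exp (\<i> * of_real \<theta>)"
  have B: "B \<noteq> 0" "cnj B \<noteq> 0" using radius_facts(4) by (simp_all add: B_def)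
  have BB: "B * cnj B = of_real (r^2)"
    unfolding B_def by (rule family_product)
  have ABC: "of_real S \<noteq> B * cnj B"
    unfolding BB of_real_eq_iff using radius_facts(6) by simp
  have disc: "(of_real S - \<alpha>)^2 + 4 * \<alpha> * B * cnj B = 0" "(of_real S - \<beta>)^2 + 4 * \<beta> * B * cnj B = 0"
    unfolding mult.assoc[of _ B "cnj B"] BB
    using family_discriminant[of \<alpha> \<beta>] family_discriminant[of \<beta> \<alpha>] pair pair' Q by simp_all
  have "int_mult (0, 0, 1) (conic_poly (of_real S) B (cnj B)) (conic_pair \<alpha> \<beta>) = 2"
    "int_mult (0, 1, 0) (conic_poly (of_real S) B (cnj B)) (conic_pair \<alpha> \<beta>) = 2"
    using int_mult_infinity1_le[OF B(2)] int_mult_infinity2_le[OF B(1)] int_mult_infinity1_ge[of 1]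
      int_mult_infinity2_ge[of 1] by (simp_all add: antisym)
  moreover have "2 \<le> int_mult y (conic_poly (of_real S) B (cnj B)) (conic_pair \<alpha> \<beta>)"
    if "y \<noteq> (0, 0, 0)" "plane_pt t y \<in> plane_locus t (conic_poly (of_real S) B (cnj B)) \<inter> quartic_surface a b Q" for y
    using that int_mult_tangent_ge[OF B(1) ABC disc that(1)]
      plane_pt_in_quartic_surface[OF pair that(1)] plane_pt_in_plane_locus[OF homogeneous_conic that(1)]
    by blast
  moreover have "irreducible_conic (conic_poly (of_real S) B (cnj B))"
    unfolding irreducible_conic_def using homogeneous_conic irreducible_conicI[OF ABC] by blast
  moreover have "cp3_sigma ` plane_locus t (conic_poly (of_real S) B (cnj B)) = plane_locus t (conic_poly (of_real S) B (cnj B))"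
    by (rule real_conic_locus) simp_all
  ultimately show ?thesis
    unfolding conic_family_conic B_def[symmetric] real_touching_conic_def special_type_def
      quartic_curve_eq_conic_pair[OF pair] by blast
qed

lemma touching_special_in_family:
  assumes Q: "q = qform Q t 1" "f = cubic a b t"
    and F: "real_touching_conic a b Q t F" "special_type a b Q t F"
  shows "\<exists>\<theta> c. c \<noteq> 0 \<and> F = cst c * conic_family q f \<theta>"
proof -
  define \<alpha> \<beta> where "\<alpha> = Complex q (sqrt (- f))" and "\<beta> = Complex q (- sqrt (- f))"
  have pair: "\<alpha> + \<beta> = 2 * of_real (qform Q t 1)" "\<alpha> * \<beta> = of_real ((qform Q t 1)^2 - cubic a b t)"
    using f by (simp_all add: \<alpha>_def \<beta>_def complex_eq_iff power2_eq_square flip: Q)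
  have "\<alpha> \<noteq> \<beta>" using f by (simp add: \<alpha>_def \<beta>_def)
  obtain c A B where c: "c \<noteq> 0" "F = cst c * conic_poly (of_real A) B (cnj B)" and B: "B \<noteq> 0"
    "(of_real A - \<alpha>)^2 + 4 * \<alpha> * of_real ((cmod B)^2) = 0"
    using real_touching_special_normal_form[OF pair \<open>\<alpha> \<noteq> \<beta>\<close> F] by blast
  have "A = S" "cmod B = r"
    using conic_coeffs_unique[OF B(1) B(2)[unfolded \<alpha>_def]] by blast+
  \<comment> \<open>Only the argument of \<open>B\<close> is left free; it supplies the
    angle.\<close>
  moreover have "B = of_real (cmod B) * exp (\<i> * of_real (Arg B))"
    using B(1) Arg_eq by blast
  ultimately have "F = cst c * conic_family q f (Arg B)"
    unfolding conic_family_conic using c(2) by simp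
  then show ?thesis using c(1) by blast
qed

end

section \<open>Sign of the quadratic form where the cubic is positive, and the proof of the
  theorem\<close>

lemma qform_continuous: "continuous_on UNIV (\<lambda>t :: real. qform Q t 1)"
  unfolding poly_qform_poly[symmetric] by (intro continuous_intros)

text \<open>At \<open>\<lambda>\<^sub>0\<close> itself, where only \<open>Q\<^sup>2 = f\<close> is known, the sign of \<open>Q\<close> follows by continuity from
  the neighbouring parameters.\<close>

lemma qform_plus_sqrt_pos:
  assumes pos: "\<And>t. cubic a b t \<ge> 0 \<Longrightarrow> t \<noteq> lam0 \<Longrightarrow> qform Q t 1 > sqrt (cubic a b t)"
    and f: "cubic a b lam > 0"
  shows "qform Q lam 1 + sqrt (cubic a b lam) > 0"
proof -
  have "qform Q lam 1 \<ge> 0"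
  proof (rule ccontr)
    assume neg: "\<not> qform Q lam 1 \<ge> 0"
    have "isCont (\<lambda>t. qform Q t 1) lam" "isCont (cubic a b) lam"
      using qform_continuous by (simp_all add: continuous_on_eq_continuous_at cubic_def[abs_def])
    then have "\<forall>\<^sub>F t in at lam. qform Q t 1 < 0" "\<forall>\<^sub>F t in at lam. cubic a b t > 0"
      using neg f by (auto simp: isCont_def intro: order_tendstoD)
    \<comment> \<open>Also true when \<open>lam\<close> equals \<open>lam0\<close>, since the
      neighbourhood is punctured; this covers the one parameter without a strict inequality.\<close>
    moreover have "\<forall>\<^sub>F t in at lam. t \<noteq> lam0"
      by (rule eventually_neq_at_within)
    ultimately have "\<forall>\<^sub>F t in at lam. False"
    proof eventually_elim
      case (elim t)
      then show False using pos[of t] real_sqrt_ge_zero[of "cubic a b t"] by linarith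
    qed
    then show False by simp
  qed
  then show ?thesis using f by (simp add: add_nonneg_pos)
qed

theorem proposition3p6:
  fixes a b lam0 lam :: real and Q :: binary_form
  assumes "a > 0" and "b > 0"
    and "\<And>t. (qform Q t 1)^2 - cubic a b t \<ge> 0"
    and "\<And>t. (qform Q t 1)^2 - cubic a b t = 0 \<longleftrightarrow> t = lam0"
    and "order lam0 ((qform_poly Q)^2 - cubic_poly a b) = 2"
    and "\<And>t. cubic a b t \<ge> 0 \<Longrightarrow> t \<noteq> lam0 \<Longrightarrow> qform Q t 1 > sqrt (cubic a b t)"
  shows
    "(cubic a b lam > 0 \<longrightarrow>
       \<not> (\<exists>F. real_touching_conic a b Q lam F \<and> special_type a b Q lam F)) \<and>
     (cubic a b lam < 0 \<longrightarrow>
       (\<forall>\<theta>. real_touching_conic a b Q lam (conic_family (qform Q lam 1) (cubic a b lam) \<theta>) \<and>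
             special_type a b Q lam (conic_family (qform Q lam 1) (cubic a b lam) \<theta>)) \<and>
       (\<forall>\<theta> \<theta>'. plane_locus lam (conic_family (qform Q lam 1) (cubic a b lam) \<theta>) =
                 plane_locus lam (conic_family (qform Q lam 1) (cubic a b lam) \<theta>') \<longleftrightarrow>
                 exp (\<i> * of_real \<theta>) = exp (\<i> * of_real \<theta>')) \<and>
       (\<forall>F. real_touching_conic a b Q lam F \<and> special_type a b Q lam F \<longrightarrow>
          (\<exists>\<theta> c. c \<noteq> 0 \<and> F = cst c * conic_family (qform Q lam 1) (cubic a b lam) \<theta>))) \<and>
     (cubic a b lam < 0 \<longrightarrow>
       (\<forall>\<theta>. \<not> (\<exists>P \<in> plane_locus lam (conic_family (qform Q lam 1) (cubic a b lam) \<theta>). cp3_sigma P = P)))"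
proof -
  have "\<not> (\<exists>F. real_touching_conic a b Q lam F \<and> special_type a b Q lam F)" if "cubic a b lam > 0"
    using no_touching_conic_positive[OF that qform_plus_sqrt_pos[OF assms(6) that]] by blast
  moreover note family_touching_special[OF _ refl refl, of a b lam Q]
    family_locus_eq_iff[of "cubic a b lam" lam "qform Q lam 1"]
    touching_special_in_family[OF _ refl refl, of a b lam Q]
    family_no_real_point[of "cubic a b lam" _ lam "qform Q lam 1"]
  ultimately show ?thesis
    by (intro conjI impI allI) blast+
qed

end
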